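(* Let $\varphi$ be an Orlicz function and let $\omega:[0,1)\to[0,\infty)$ be a weight function that is not identically zero. Then the Orlicz-Lorentz space $\Lambda^\circ_{\varphi,\omega}[0,1)$ (endowed with the Orlicz norm) is non-square if and only if $\alpha:=\sup\{t\ge0:\omega(t)>0\}\in(\tfrac12,1]$.
   Context: Orlicz function: $\varphi:\mathbb{R}\to[0,\infty)$ is convex, even, $\varphi(0)=0$, $\varphi(u)>0$ for all $u>0$, $\lim_{u\to0}\varphi(u)/u=0$ and $\lim_{u\to\infty}\varphi(u)/u=\infty$. Its complementary function is $\psi(v)=\sup_{u>0}\{|uv|-\varphi(u)\}$, $v\in\mathbb{R}$ (again an Orlicz function). Rearrangements: let $\gamma=1$ and let $\mu$ be Lebesgue measure. For measurable $x:[0,\gamma)\to\mathbb{R}$, put $d_x(\theta)=\mu\{s\in[0,\gamma):|x(s)|>\theta\}$ and $x^\ast(t)=\inf\{\theta>0:d_x(\theta)\le t\}$, $t\ge0$. Weight function: $\omega:[0,\gamma)\to[0,\infty)$ that is non-increasing and locally integrable (so integrable near $0$). Put $\rho_{\varphi,\omega}(x)=\int_0^\gamma\varphi(x^\ast(t))\omega(t)\,dt$, and similarly $\rho_{\psi,\omega}$. The Orlicz-Lorentz space $\Lambda_{\varphi,\omega}[0,\gamma)$ is the set of (classes of a.e. equal) measurable functions $x$ on $[0,\gamma)$ with $\rho_{\varphi,\omega}(\lambda x)<\infty$ for some $\lambda>0$. The Orlicz norm is $$\|x\|^\circ_{\varphi,\omega}=\sup_{\rho_{\psi,\omega}(y)\le1}\int_0^\gamma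 x^\ast(t)y^\ast(t)\omega(t)\,dt=\inf_{k>0}\frac1k\bigl(1+\rho_{\varphi,\omega}(kx)\bigr),$$ the supremum being over measurable $y$ on $[0,\gamma)$ (the second equality is known). $\Lambda^\circ_{\varphi,\omega}[0,\gamma)$ denotes $\Lambda_{\varphi,\omega}[0,\gamma)$ with this norm; it is a Banach space. A Banach space $X$ with unit sphere $S(X)$ is non-square if $\min\{\|\frac{x-y}{2}\|,\|\frac{x+y}{2}\|\}<1$ for all $x,y\in S(X)$. *)

theory Defs
  imports "HOL-Analysis.Analysis"
begin

definition orlicz_function :: "(real \<Rightarrow> real) \<Rightarrow> bool" where
  "orlicz_function \<phi> \<longleftrightarrow>
     (\<forall>u. 0 \<le> \<phi> u) \<and> convex_on UNIV \<phi> \<and> (\<forall>u. \<phi> (- u) = \<phi> u) \<and> \<phi> 0 = 0 \<and>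
     (\<forall>u>0. 0 < \<phi> u) \<and>
     ((\<lambda>u. \<phi> u / u) \<longlongrightarrow> 0) (at 0) \<and>
     filterlim (\<lambda>u. \<phi> u / u) at_top at_top"

(* For an Orlicz function the supremum is finite, because \<phi> u / u tends to infinity. *)
definition complementary :: "(real \<Rightarrow> real) \<Rightarrow> real \<Rightarrow> real" where
  "complementary \<phi> v = (SUP u\<in>{0<..}. \<bar>u * v\<bar> - \<phi> u)"

(* Monotonicity is only required on the open interval: a finite value at 0 bounding all others
   would exclude weights that are unbounded near 0, which the integrability condition is meant
   to admit. The value at 0 plays no role in the integrals below. *)
definition weight_function :: "(real \<Rightarrow> real) \<Rightarrow> bool" where
  "weight_function \<omega> \<longleftrightarrow>
     (\<forall>t\<in>{0..<1}. 0 \<le> \<omega> t) \<and> antimono_on {0<..<1} \<omega> \<and>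
     (\<forall>b\<in>{0<..<1}. set_integrable lebesgue {0..b} \<omega>)"

definition distribution_fun :: "(real \<Rightarrow> real) \<Rightarrow> real \<Rightarrow> real" where
  "distribution_fun x \<theta> = measure lebesgue {s\<in>{0..<1}. \<bar>x s\<bar> > \<theta>}"

(* For measurable x and t > 0 the set is nonempty. It is empty only if t = 0 and x is essentially
   unbounded; then the true value is infinite and the real-valued Inf is a junk value, but it
   enters the integrals below only on the null set {0}. *)
definition rearrangement :: "(real \<Rightarrow> real) \<Rightarrow> real \<Rightarrow> real" where
  "rearrangement x t = Inf {\<theta>. 0 < \<theta> \<and> distribution_fun x \<theta> \<le> t}"

definition modular :: "(real \<Rightarrow> real) \<Rightarrow> (real \<Rightarrow> real) \<Rightarrow> (real \<Rightarrow> real) \<Rightarrow> ennreal" where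
  "modular \<phi> \<omega> x =
     (\<integral>\<^sup>+t. ennreal (\<phi> (rearrangement x t) * \<omega> t) \<partial>lebesgue_on {0..<1})"

(* Elements are represented by functions rather than by classes of a.e. equal functions;
   see rearrangement_cong_AE and the lemmas following it for independence of the representative. *)
definition orlicz_lorentz_space :: "(real \<Rightarrow> real) \<Rightarrow> (real \<Rightarrow> real) \<Rightarrow> (real \<Rightarrow> real) set" where
  "orlicz_lorentz_space \<phi> \<omega> =
     {x \<in> borel_measurable (lebesgue_on {0..<1}).
        \<exists>c>0. modular \<phi> \<omega> (\<lambda>s. c * x s) < \<infinity>}"

definition orlicz_norm :: "(real \<Rightarrow> real) \<Rightarrow> (real \<Rightarrow> real) \<Rightarrow> (real \<Rightarrow> real) \<Rightarrow> ennreal" where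
  "orlicz_norm \<phi> \<omega> x =
     (SUP y\<in>{y \<in> borel_measurable (lebesgue_on {0..<1}). modular (complementary \<phi>) \<omega> y \<le> 1}.
        \<integral>\<^sup>+t. ennreal (rearrangement x t * rearrangement y t * \<omega> t) \<partial>lebesgue_on {0..<1})"

(* V is the underlying set of a function space and N its norm, computed in the extended
   nonnegative reals. *)
definition non_square :: "('a \<Rightarrow> real) set \<Rightarrow> (('a \<Rightarrow> real) \<Rightarrow> ennreal) \<Rightarrow> bool" where
  "non_square V N \<longleftrightarrow>
     (\<forall>x\<in>V. \<forall>y\<in>V. N x = 1 \<longrightarrow> N y = 1 \<longrightarrow>
        min (N (\<lambda>s. (x s - y s) / 2)) (N (\<lambda>s. (x s + y s) / 2)) < 1)"

lemma rearrangement_cong_AE: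
  assumes [measurable]: "x \<in> borel_measurable (lebesgue_on {0..<1})"
      "y \<in> borel_measurable (lebesgue_on {0..<1})"
    and ae: "AE s in lebesgue_on {0..<1}. x s = y s"
  shows "rearrangement x = rearrangement y"
proof -
  have eq: "measure lebesgue {s\<in>{0..<1}. \<bar>z s\<bar> > \<theta>} =
      measure (lebesgue_on {0..<1}) {s\<in>space (lebesgue_on {0..<1}). \<bar>z s\<bar> > \<theta>}"
    for z :: "real \<Rightarrow> real" and \<theta>
    by (subst measure_restrict_space) (auto simp: space_restrict_space)
  have "distribution_fun x \<theta> = distribution_fun y \<theta>" for \<theta>
    unfolding distribution_fun_def eq
  proof (rule measure_eq_AE)
    show "AE s in lebesgue_on {0..<1}.
        s \<in> {s \<in> space (lebesgue_on {0..<1}). \<bar>x s\<bar> > \<theta>} \<longleftrightarrow>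
        s \<in> {s \<in> space (lebesgue_on {0..<1}). \<bar>y s\<bar> > \<theta>}"
      using ae by eventually_elim simp
  qed measurable
  then show ?thesis
    unfolding rearrangement_def by presburger
qed

lemma orlicz_norm_cong_AE:
  assumes "x \<in> borel_measurable (lebesgue_on {0..<1})"
    and "y \<in> borel_measurable (lebesgue_on {0..<1})"
    and "AE s in lebesgue_on {0..<1}. x s = y s"
  shows "orlicz_norm \<phi> \<omega> x = orlicz_norm \<phi> \<omega> y"
  unfolding orlicz_norm_def rearrangement_cong_AE[OF assms] ..

lemma orlicz_lorentz_space_cong_AE:
  assumes "x \<in> borel_measurable (lebesgue_on {0..<1})"
    and "y \<in> borel_measurable (lebesgue_on {0..<1})"
    and "AE s in lebesgue_on {0..<1}. x s = y s"
  shows "x \<in> orlicz_lorentz_space \<phi> \<omega> \<longleftrightarrow> y \<in> orlicz_lorentz_space \<phi> \<omega>"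
proof -
  have "rearrangement (\<lambda>s. c * x s) = rearrangement (\<lambda>s. c * y s)" for c
    by (rule rearrangement_cong_AE) (use assms in auto)
  then show ?thesis
    using assms unfolding orlicz_lorentz_space_def modular_def by auto
qed

end

theory Submission
  imports Defs
begin

text \<open>
  Every \<open>x\<close> of Orlicz norm 1 satisfies \<open>k * (1 + \<rho>(x / k)) \<le> 1\<close> for some \<open>k > 0\<close>, where \<open>\<rho>\<close> is the modular
  of \<open>\<phi>\<close>. Given a second such \<open>y\<close> with constant \<open>m\<close>, put \<open>l = k + m\<close>, \<open>a = k / l\<close>, \<open>b = m / l\<close> and
  \<open>G = a * \<phi>(x / k) + b * \<phi>(y / m)\<close>. By convexity \<open>F\<close> and \<open>F'\<close>, defined as \<open>\<phi>((x + y) / l)\<close> and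
  \<open>\<phi>((x - y) / l)\<close>, lie below \<open>G\<close>, and wherever \<open>G\<close> is not 0 one of the two inequalities is strict.
  If both \<open>x + y\<close> and \<open>x - y\<close> had norm at least 2, then \<open>F\<close>, \<open>F'\<close> and \<open>G\<close> would have the same
  weighted integral of the rearrangement. As \<open>\<omega>\<close> is positive on \<open>(0, \<alpha>)\<close>, this forces \<open>F = G\<close>
  and \<open>F' = G\<close> on sets of measure nearly \<open>\<alpha>\<close>, which overlap when \<open>\<alpha> > 1/2\<close>. When \<open>\<alpha> \<le> 1/2\<close>, a constant
  and the same constant with its sign switched on \<open>[1/2, 1)\<close> violate non-squareness, as their
  half sum and half difference are constant on sets of measure 1/2.
\<close>

section \<open>Orlicz functions and their complements\<close>

context
  fixes \<phi> :: "real \<Rightarrow> real"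
  assumes orlicz: "orlicz_function \<phi>"
begin

lemma orlicz_nonneg: "0 \<le> \<phi> u"
  and orlicz_convex: "convex_on UNIV \<phi>"
  and orlicz_minus: "\<phi> (- u) = \<phi> u"
  and orlicz_zero: "\<phi> 0 = 0"
  and orlicz_tendsto_0: "((\<lambda>u. \<phi> u / u) \<longlongrightarrow> 0) (at 0)"
  and orlicz_superlinear: "filterlim (\<lambda>u. \<phi> u / u) at_top at_top"
  using orlicz unfolding orlicz_function_def by auto

lemma orlicz_abs: "\<phi> \<bar>u\<bar> = \<phi> u"
  by (simp add: abs_if orlicz_minus)

lemma orlicz_pos: "u \<noteq> 0 \<Longrightarrow> 0 < \<phi> u"
  using orlicz orlicz_abs[of u] unfolding orlicz_function_def by (metis zero_less_abs_iff)

lemma orlicz_convexD: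
  "0 \<le> a \<Longrightarrow> 0 \<le> b \<Longrightarrow> a + b = 1 \<Longrightarrow> \<phi> (a * u + b * v) \<le> a * \<phi> u + b * \<phi> v"
  using orlicz_convex unfolding convex_on_def by auto

lemma orlicz_less:
  assumes "0 \<le> u" "u < v"
  shows "\<phi> u < \<phi> v"
proof -
  have "\<phi> u \<le> u / v * \<phi> v"
    using orlicz_convexD[of "u / v" "1 - u / v" v 0] assms by (simp add: orlicz_zero)
  also have "\<dots> < 1 * \<phi> v"
    by (rule mult_strict_right_mono) (use assms in \<open>auto simp: orlicz_pos\<close>)
  finally show ?thesis by simp
qed

lemma orlicz_le: "0 \<le> u \<Longrightarrow> u \<le> v \<Longrightarrow> \<phi> u \<le> \<phi> v"
  using orlicz_less[of u v] by (cases "u = v") auto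

lemma orlicz_less_abs: "\<bar>u\<bar> < \<bar>v\<bar> \<Longrightarrow> \<phi> u < \<phi> v"
  using orlicz_less[of "\<bar>u\<bar>" "\<bar>v\<bar>"] by (simp add: orlicz_abs)

lemma orlicz_continuous: "continuous_on UNIV \<phi>"
  using convex_on_continuous[OF open_UNIV orlicz_convex] .

lemma orlicz_measurable: "\<phi> \<in> borel_measurable borel"
  by (rule borel_measurable_continuous_onI[OF orlicz_continuous])

text \<open>Equality would make \<open>\<phi>\<close> linear near 0, against \<open>\<phi> u / u \<longlonglongrightarrow> 0\<close>.\<close>
lemma orlicz_scale_less:
  assumes a: "0 < a" "a < 1" and "u \<noteq> 0"
  shows "\<phi> (a * u) < a * \<phi> u"
proof -
  have *: "\<phi> (a * u) < a * \<phi> u" if "u > 0" for u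
  proof (rule ccontr)
    assume "\<not> \<phi> (a * u) < a * \<phi> u"
    then have ge: "a * \<phi> u \<le> \<phi> (a * u)" by simp
    have "eventually (\<lambda>t. \<phi> t / t < \<phi> u / u) (at 0)"
      by (rule order_tendstoD(2)[OF orlicz_tendsto_0]) (use \<open>u > 0\<close> orlicz_pos[of u] in simp)
    then have "eventually (\<lambda>t. \<phi> t / t < \<phi> u / u) (at_right 0)"
      by (rule filter_leD[rotated]) (simp add: at_le)
    moreover have "eventually (\<lambda>t. t \<in> {0<..<a * u}) (at_right 0)"
      by (rule eventually_at_right_real) (use a \<open>u > 0\<close> in auto)
    ultimately have "eventually (\<lambda>t. \<phi> t / t < \<phi> u / u \<and> t \<in> {0<..<a * u}) (at_right 0)"
      by (rule eventually_conj)
    then obtain t where t: "\<phi> t / t < \<phi> u / u" "0 < t" "t < a * u"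
      using eventually_happens'[OF trivial_limit_at_right_real] by auto
    have "a * u < u" using a \<open>u > 0\<close> by simp
    \<comment> \<open>\<open>a * u\<close> lies strictly between \<open>t\<close> and
      \<open>u\<close>, and \<open>r\<close> is its barycentric weight at \<open>t\<close>. As the
      quotient is smaller at \<open>t\<close> than at \<open>u\<close>, the chord from
      \<open>t\<close> to \<open>u\<close> passes below \<open>a * \<phi> u\<close> at this point,
      against \<open>ge\<close>.\<close>
    define r where "r = (u - a * u) / (u - t)"
    have r: "0 < r" "r < 1" using t \<open>a * u < u\<close> by (auto simp: r_def)
    have "r * (u - t) = u - a * u" using t \<open>a * u < u\<close> by (simp add: r_def)
    then have au: "a * u = r * t + (1 - r) * u" by (simp add: algebra_simps)
    have "a * \<phi> u \<le> r * \<phi> t + (1 - r) * \<phi> u"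
      using ge orlicz_convexD[of r "1 - r" t u] r au by simp
    also have "\<dots> < r * (t * \<phi> u / u) + (1 - r) * \<phi> u"
      using r t \<open>u > 0\<close> by (simp add: field_simps)
    also have "\<dots> = (r * t + (1 - r) * u) * \<phi> u / u"
      using \<open>u > 0\<close> by (simp add: field_simps)
    also have "\<dots> = a * \<phi> u" unfolding au[symmetric] using \<open>u > 0\<close> by simp
    finally show False by simp
  qed
  show ?thesis
    using *[of "\<bar>u\<bar>"] a \<open>u \<noteq> 0\<close> by (metis abs_mult abs_of_pos orlicz_abs zero_less_abs_iff)
qed

text \<open>Superlinear growth makes \<open>\<phi>\<close> unbounded, and the intermediate value
  theorem does the rest. Surjectivity is what lets rearrangements be carried through
  \<open>\<phi>\<close>.\<close>

lemma orlicz_image: "\<phi> ` {0..} = {0..}"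
proof (intro equalityI subsetI)
  fix v :: real assume "v \<in> {0..}"
  obtain N where N: "\<And>u. u \<ge> N \<Longrightarrow> v \<le> \<phi> u / u"
    using orlicz_superlinear unfolding filterlim_at_top eventually_at_top_linorder by blast
  \<comment> \<open>\<open>u \<ge> 1\<close> gives \<open>v \<le> v * u\<close>, and
    \<open>u \<ge> N\<close> gives \<open>v * u \<le> \<phi> u\<close>.\<close>
  define u where "u = max 1 N"
  have u: "u \<ge> 1" "v \<le> \<phi> u / u" using N[of u] by (auto simp: u_def)
  have "v \<le> v * u" using u \<open>v \<in> {0..}\<close> by (simp add: mult_le_cancel_left1)
  also have "\<dots> \<le> \<phi> u" using u by (simp add: field_simps)
  finally have "v \<le> \<phi> u" .
  moreover have "continuous_on {0..u} \<phi>" using orlicz_continuous continuous_on_subset by blast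
  ultimately obtain w where "0 \<le> w" "\<phi> w = v"
    using IVT'[of \<phi> 0 v u] u \<open>v \<in> {0..}\<close> orlicz_zero by auto
  then show "v \<in> \<phi> ` {0..}" by auto
qed (auto simp: orlicz_nonneg)

text \<open>If \<open>u\<close> or \<open>v\<close> is 0, strictness comes from
  \<open>orlicz_scale_less\<close>. Otherwise \<open>a * u\<close> and \<open>b * v\<close> have
  either equal or opposite signs, so their difference or their sum is strictly smaller in absolute
  value than \<open>a * \<bar>u\<bar> + b * \<bar>v\<bar>\<close>, and \<open>\<phi>\<close> is
  strictly increasing.\<close>

lemma orlicz_convex_combination_less:
  assumes ab: "0 < a" "0 < b" "a + b = 1" and nz: "u \<noteq> 0 \<or> v \<noteq> 0"
  shows "\<phi> (a * u + b * v) < a * \<phi> u + b * \<phi> v \<or> \<phi> (a * u - b * v) < a * \<phi> u + b * \<phi> v"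
proof (cases "u = 0 \<or> v = 0")
  case True
  with nz ab orlicz_scale_less[of a u] orlicz_scale_less[of b v] show ?thesis
    by (auto simp: orlicz_zero)
next
  case False
  have "\<phi> (a * \<bar>u\<bar> + b * \<bar>v\<bar>) \<le> a * \<phi> u + b * \<phi> v"
    using orlicz_convexD[of a b "\<bar>u\<bar>" "\<bar>v\<bar>"] ab by (simp add: orlicz_abs)
  moreover have "\<bar>a * u + b * v\<bar> < \<bar>a * \<bar>u\<bar> + b * \<bar>v\<bar>\<bar> \<or> \<bar>a * u - b * v\<bar> < \<bar>a * \<bar>u\<bar> + b * \<bar>v\<bar>\<bar>"
  proof -
    have "\<bar>a * \<bar>u\<bar> + b * \<bar>v\<bar>\<bar> = \<bar>a * u\<bar> + \<bar>b * v\<bar>" using ab by (simp add: abs_mult)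
    moreover have "a * u \<noteq> 0" "b * v \<noteq> 0" using False ab by auto
    ultimately show ?thesis by linarith
  qed
  ultimately show ?thesis using orlicz_less_abs by (meson order_less_le_trans)
qed

section \<open>The complementary function and Young's inequality\<close>

lemma complementary_bdd: "bdd_above ((\<lambda>u. \<bar>u * v\<bar> - \<phi> u) ` {0<..})"
proof -
  obtain N where N: "\<And>u. u \<ge> N \<Longrightarrow> \<bar>v\<bar> \<le> \<phi> u / u"
    using orlicz_superlinear unfolding filterlim_at_top eventually_at_top_linorder by blast
  \<comment> \<open>From \<open>N\<close> on the term is at most 0; below \<open>N\<close> already
    \<open>\<bar>u * v\<bar>\<close> is at most \<open>\<bar>N * v\<bar>\<close>.\<close>
  have "\<bar>u * v\<bar> - \<phi> u \<le> \<bar>N * v\<bar>" if "u > 0" for u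
  proof (cases "u \<ge> N")
    case True
    then have "\<bar>u * v\<bar> \<le> \<phi> u" using N[of u] that by (simp add: field_simps abs_mult)
    then show ?thesis using abs_ge_zero[of "N * v"] by linarith
  next
    case False
    then have "\<bar>u * v\<bar> \<le> \<bar>N * v\<bar>" using that by (simp add: abs_mult mult_right_mono)
    then show ?thesis using orlicz_nonneg[of u] by linarith
  qed
  then show ?thesis by (intro bdd_aboveI[of _ "\<bar>N * v\<bar>"]) auto
qed

lemma complementary_ge: "u > 0 \<Longrightarrow> \<bar>u * v\<bar> - \<phi> u \<le> complementary \<phi> v"
  unfolding complementary_def by (rule cSUP_upper[OF _ complementary_bdd]) simp

lemma complementary_le: "(\<And>u. u > 0 \<Longrightarrow> \<bar>u * v\<bar> - \<phi> u \<le> B) \<Longrightarrow> complementary \<phi> v \<le> B"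
  unfolding complementary_def by (rule cSUP_least) auto

text \<open>The supremum runs over \<open>u > 0\<close> only, so the value 0 belonging to
  \<open>u = 0\<close> has to be approached along arguments at which \<open>\<phi>\<close> is
  arbitrarily small.\<close>

lemma complementary_nonneg: "0 \<le> complementary \<phi> v"
proof (rule field_le_epsilon)
  fix e :: real assume "e > 0"
  then obtain u where u: "u \<ge> 0" "\<phi> u = e"
    using orlicz_image by (metis (no_types, lifting) atLeast_iff image_iff less_imp_le)
  with \<open>e > 0\<close> orlicz_zero have "u > 0" by (cases "u = 0") auto
  from complementary_ge[OF this, of v] u show "0 \<le> complementary \<phi> v + e"
    using abs_ge_zero[of "u * v"] by linarith
qed

lemma young: "\<bar>u * v\<bar> \<le> \<phi> u + complementary \<phi> v"
  using complementary_ge[of "\<bar>u\<bar>" v] complementary_nonneg[of v]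
  by (cases "u = 0") (auto simp: abs_mult orlicz_abs orlicz_zero)

lemma complementary_zero: "complementary \<phi> 0 = 0"
  by (rule antisym[OF complementary_le complementary_nonneg]) (simp add: orlicz_nonneg)

lemma complementary_convex:
  assumes "0 \<le> a" "0 \<le> b" "a + b = 1"
  shows "complementary \<phi> (a * v + b * w) \<le> a * complementary \<phi> v + b * complementary \<phi> w"
proof (rule complementary_le)
  fix u :: real assume "u > 0"
  have "\<bar>u * (a * v + b * w)\<bar> \<le> a * \<bar>u * v\<bar> + b * \<bar>u * w\<bar>"
    using assms abs_triangle_ineq[of "a * (u * v)" "b * (u * w)"]
    by (simp add: abs_mult algebra_simps)
  moreover have "\<phi> u = a * \<phi> u + b * \<phi> u" using assms by (metis distrib_right mult_1)
  ultimately have "\<bar>u * (a * v + b * w)\<bar> - \<phi> u \<le> a * (\<bar>u * v\<bar> - \<phi> u) + b * (\<bar>u * w\<bar> - \<phi> u)"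
    by (simp add: algebra_simps)
  also have "\<dots> \<le> a * complementary \<phi> v + b * complementary \<phi> w"
    using assms complementary_ge[OF \<open>u > 0\<close>] by (intro add_mono mult_left_mono) auto
  finally show "\<bar>u * (a * v + b * w)\<bar> - \<phi> u \<le> a * complementary \<phi> v + b * complementary \<phi> w" .
qed

lemma complementary_scale_le:
  "0 \<le> c \<Longrightarrow> c \<le> 1 \<Longrightarrow> complementary \<phi> (c * v) \<le> c * complementary \<phi> v"
  using complementary_convex[of c "1 - c" v 0] by (simp add: complementary_zero)

lemma complementary_le_abs:
  assumes "\<bar>v\<bar> \<le> \<bar>w\<bar>"
  shows "complementary \<phi> v \<le> complementary \<phi> w"
proof (rule complementary_le)
  fix u :: real assume "u > 0"
  then have "\<bar>u * v\<bar> \<le> \<bar>u * w\<bar>" using assms by (simp add: abs_mult)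
  then show "\<bar>u * v\<bar> - \<phi> u \<le> complementary \<phi> w"
    using complementary_ge[OF \<open>u > 0\<close>, of w] by linarith
qed

lemma complementary_continuous: "continuous_on UNIV (complementary \<phi>)"
  by (rule convex_on_continuous) (auto simp: convex_on_def complementary_convex)

lemma complementary_measurable: "complementary \<phi> \<in> borel_measurable borel"
  by (rule borel_measurable_continuous_onI[OF complementary_continuous])

text \<open>\<open>s\<close> is a choice of subgradient of \<open>\<phi>\<close>. The supporting
  line at \<open>u\<close> shows that no argument does better than \<open>u\<close> in the supremum
  defining the complement at \<open>s u\<close>, so Young's inequality becomes an equality.
  Monotonicity keeps \<open>s\<close> composed with a non-increasing nonnegative function
  non-increasing.\<close>

lemma young_equality:
  obtains s where "mono_on {0..} s" "\<And>u. 0 \<le> u \<Longrightarrow> 0 \<le> s u"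
    "\<And>u. 0 \<le> u \<Longrightarrow> complementary \<phi> (s u) \<le> u * s u - \<phi> u"
proof -
  have "\<exists>s. \<forall>v. \<phi> v \<ge> \<phi> u + s * (v - u)" for u
    using convex_le_Inf_differential[OF orlicz_convex, of u] by auto
  then obtain s where s: "\<And>u v. \<phi> v \<ge> \<phi> u + s u * (v - u)" by metis
  have mono: "s u \<le> s v" if "u \<le> v" for u v
  proof (cases "u = v")
    case False
    have "(s u - s v) * (v - u) \<le> 0" using s[of u v] s[of v u] by (simp add: algebra_simps)
    then show ?thesis using False that by (auto simp: mult_le_0_iff)
  qed simp
  \<comment> \<open>A negative slope at 0 would give \<open>\<phi> t / t \<le> s 0 < 0\<close> for
    all \<open>t < 0\<close>, against the limit 0 of the quotient.\<close>
  have s0: "0 \<le> s 0"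
  proof (rule ccontr)
    assume "\<not> 0 \<le> s 0"
    then have "eventually (\<lambda>t. s 0 < \<phi> t / t) (at 0)"
      by (intro order_tendstoD(1)[OF orlicz_tendsto_0]) simp
    then have "eventually (\<lambda>t. s 0 < \<phi> t / t) (at_left 0)"
      by (rule filter_leD[rotated]) (simp add: at_le)
    moreover have "eventually (\<lambda>t. t \<in> {-1<..<0}) (at_left (0::real))"
      by (rule eventually_at_left_real) auto
    ultimately have "eventually (\<lambda>t. s 0 < \<phi> t / t \<and> t \<in> {-1<..<0}) (at_left 0)"
      by (rule eventually_conj)
    then obtain t where "s 0 < \<phi> t / t" "t < 0"
      using eventually_happens'[OF trivial_limit_at_left_real] by auto
    then show False using s[of 0 t] by (simp add: orlicz_zero field_simps)
  qed
  show ?thesis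
  proof
    show "mono_on {0..} s" by (auto intro!: mono_onI mono)
    show nonneg: "0 \<le> s u" if "0 \<le> u" for u using mono[OF that] s0 by simp
    show "complementary \<phi> (s u) \<le> u * s u - \<phi> u" if "0 \<le> u" for u
      by (rule complementary_le)
        (use s[of u] nonneg[OF that] in \<open>auto simp: abs_mult algebra_simps\<close>)
  qed
qed

end

section \<open>Distribution functions and rearrangements\<close>

abbreviation leb01 :: "real measure" where
  "leb01 \<equiv> lebesgue_on {0..<1}"

interpretation leb01: finite_measure leb01
  by (rule finite_measure_lebesgue_on) (rule bounded_set_imp_lmeasurable, auto)

text \<open>Monotonicity is known on the open interval only, so \<open>g\<close> is cut off there
  and its arbitrary value at 0 is restored by a case distinction.\<close>

lemma antimono_measurable_leb01:
  fixes g :: "real \<Rightarrow> real"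
  assumes "antimono_on {0<..<1} g"
  shows "g \<in> borel_measurable leb01"
proof -
  have "mono_on {0<..<1} (\<lambda>t. - g t)"
    using assms by (auto simp: monotone_on_def)
  then have "(\<lambda>t. - g t) \<in> borel_measurable (restrict_space borel {0<..<1})"
    by (rule borel_measurable_mono_on_fnc)
  then have "(\<lambda>t. - (- g t)) \<in> borel_measurable (restrict_space borel {0<..<1})"
    by (rule borel_measurable_uminus)
  then have "(\<lambda>t. indicator {0<..<1} t *\<^sub>R g t) \<in> borel_measurable borel"
    by (simp add: borel_measurable_restrict_space_iff)
  then have [measurable]: "(\<lambda>t. indicator {0<..<1} t *\<^sub>R g t) \<in> borel_measurable leb01"
    by (intro measurable_restrict_space1 measurable_completion) simp
  have [measurable]: "(\<lambda>t. t) \<in> borel_measurable leb01"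
    by (intro measurable_restrict_space1 measurable_completion) simp
  have "(\<lambda>t. if t = 0 then c else indicator {0<..<1} t *\<^sub>R g t) \<in> borel_measurable leb01" for c
    by measurable
  from this[of "g 0"] show ?thesis
    by (rule measurable_cong[THEN iffD1, rotated]) (auto simp: indicator_def)
qed

lemma AE_leb01_pos: "AE t in leb01. 0 < t \<and> t < 1"
proof -
  have "AE t in lebesgue. t \<noteq> (0::real)"
    by (rule AE_completion) (rule AE_lborel_singleton)
  then have "AE t in leb01. t \<noteq> 0"
    by (subst AE_restrict_space_iff) (auto elim: eventually_mono)
  then show ?thesis
    using AE_space by eventually_elim auto
qed

lemma emeasure_leb01_ivl:
  assumes "0 \<le> a" "a \<le> b" "b \<le> 1" shows "emeasure leb01 {a<..<b} = ennreal (b - a)"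
proof -
  have "emeasure leb01 {a<..<b} = emeasure lborel {a<..<b}"
    using assms by (subst emeasure_restrict_space) auto
  then show ?thesis using assms by simp
qed

lemma distribution_fun_alt:
  "distribution_fun x \<theta> = measure leb01 {s \<in> space leb01. \<theta> < \<bar>x s\<bar>}"
  unfolding distribution_fun_def by (subst measure_restrict_space) auto

lemma distribution_fun_le_1: "distribution_fun x \<theta> \<le> 1"
proof -
  have "distribution_fun x \<theta> \<le> measure leb01 (space leb01)"
    unfolding distribution_fun_alt by (rule leb01.bounded_measure)
  then show ?thesis by (simp add: measure_restrict_space)
qed

lemma distribution_fun_nonneg: "0 \<le> distribution_fun x \<theta>"
  by (simp add: distribution_fun_def)

context
  fixes x :: "real \<Rightarrow> real"
  assumes x [measurable]: "x \<in> borel_measurable leb01"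
begin

lemma superlevel_sets: "{s \<in> space leb01. \<theta> < \<bar>x s\<bar>} \<in> sets leb01"
  by measurable

lemma distribution_fun_antimono: "\<theta> \<le> \<theta>' \<Longrightarrow> distribution_fun x \<theta>' \<le> distribution_fun x \<theta>"
  unfolding distribution_fun_alt by (rule leb01.finite_measure_mono[OF _ superlevel_sets]) auto

text \<open>Right continuity of the distribution function: the superlevel sets at
  \<open>\<theta> + 1 / real (Suc n)\<close> increase to the one at \<open>\<theta>\<close>.\<close>

lemma distribution_fun_le_of_greater:
  assumes "\<And>\<theta>'. \<theta> < \<theta>' \<Longrightarrow> distribution_fun x \<theta>' \<le> t"
  shows "distribution_fun x \<theta> \<le> t"
proof -
  define A where "A n = {s \<in> space leb01. \<theta> + 1 / real (Suc n) < \<bar>x s\<bar>}" for n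
  have "(\<lambda>n. measure leb01 (A n)) \<longlonglongrightarrow> measure leb01 (\<Union>n. A n)"
  proof (rule leb01.finite_Lim_measure_incseq)
    show "range A \<subseteq> sets leb01" unfolding A_def using superlevel_sets by blast
    show "incseq A"
      unfolding incseq_def A_def
      by (auto elim!: order.strict_trans1[rotated] intro!: divide_left_mono)
  qed
  moreover have "(\<Union>n. A n) = {s \<in> space leb01. \<theta> < \<bar>x s\<bar>}"
  proof (intro equalityI subsetI)
    fix s assume s: "s \<in> {s \<in> space leb01. \<theta> < \<bar>x s\<bar>}"
    then obtain n where "inverse (real (Suc n)) < \<bar>x s\<bar> - \<theta>"
      using reals_Archimedean[of "\<bar>x s\<bar> - \<theta>"] by auto
    then show "s \<in> (\<Union>n. A n)" using s by (auto simp: A_def inverse_eq_divide intro!: exI[of _ n])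
  qed (auto simp: A_def elim!: order.strict_trans1[rotated])
  moreover have "measure leb01 (A n) \<le> t" for n
    using assms[of "\<theta> + 1 / real (Suc n)"] by (simp add: A_def distribution_fun_alt)
  ultimately show ?thesis
    unfolding distribution_fun_alt by (auto intro: LIMSEQ_le_const2)
qed

text \<open>As \<open>x\<close> has finite values, its superlevel sets shrink to the empty set, and
  their finite measures tend to 0. Hence the infimum defining the rearrangement is over a nonempty
  set when \<open>t > 0\<close>.\<close>

lemma distribution_fun_small:
  assumes "0 < t"
  obtains \<theta> where "0 < \<theta>" "distribution_fun x \<theta> \<le> t"
proof -
  define A where "A n = {s \<in> space leb01. real (Suc n) < \<bar>x s\<bar>}" for n
  have "(\<lambda>n. measure leb01 (A n)) \<longlonglongrightarrow> measure leb01 (\<Inter>n. A n)"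
  proof (rule leb01.finite_Lim_measure_decseq)
    show "range A \<subseteq> sets leb01" unfolding A_def using superlevel_sets by blast
    show "decseq A" unfolding decseq_def A_def by auto
  qed
  moreover have "(\<Inter>n. A n) = {}"
  proof -
    have "\<exists>n. \<not> real (Suc n) < \<bar>x s\<bar>" for s
      using reals_Archimedean2[of "\<bar>x s\<bar>"] by (metis less_imp_le not_less of_nat_Suc order.trans
          le_add_same_cancel2 zero_le_one add.commute)
    then show ?thesis by (auto simp: A_def)
  qed
  ultimately have "eventually (\<lambda>n. measure leb01 (A n) < t) sequentially"
    using order_tendstoD(2)[of _ 0 sequentially t] \<open>0 < t\<close> by simp
  then obtain n where "measure leb01 (A n) < t"
    by (auto simp: eventually_sequentially)
  then show ?thesis
    using that[of "real (Suc n)"] by (simp add: A_def distribution_fun_alt)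
qed

section \<open>The rearrangement as generalised inverse of the distribution function\<close>

lemma rearrangement_le_iff:
  assumes "0 < t" "0 \<le> \<theta>"
  shows "rearrangement x t \<le> \<theta> \<longleftrightarrow> distribution_fun x \<theta> \<le> t"
proof
  let ?A = "{\<theta>. 0 < \<theta> \<and> distribution_fun x \<theta> \<le> t}"
  have ne: "?A \<noteq> {}" using distribution_fun_small[OF \<open>0 < t\<close>] by blast
  have bdd: "bdd_below ?A" by (auto intro: bdd_belowI[of _ 0] less_imp_le)
  show "distribution_fun x \<theta> \<le> t" if le: "rearrangement x t \<le> \<theta>"
  proof (rule distribution_fun_le_of_greater)
    fix \<theta>' assume "\<theta> < \<theta>'"
    then have "Inf ?A < \<theta>'" using le by (simp add: rearrangement_def)
    then obtain \<eta> where "\<eta> \<in> ?A" "\<eta> < \<theta>'" using cInf_lessD[OF ne] by blast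
    then show "distribution_fun x \<theta>' \<le> t"
      using distribution_fun_antimono[of \<eta> \<theta>'] by auto
  qed
  show "rearrangement x t \<le> \<theta>" if d: "distribution_fun x \<theta> \<le> t"
  proof (rule field_le_epsilon)
    fix e :: real assume "e > 0"
    then have "\<theta> + e \<in> ?A"
      using distribution_fun_antimono[of \<theta> "\<theta> + e"] d \<open>0 \<le> \<theta>\<close> by auto
    then show "rearrangement x t \<le> \<theta> + e"
      unfolding rearrangement_def by (rule cInf_lower[OF _ bdd])
  qed
qed

lemma less_rearrangement_iff:
  "0 < t \<Longrightarrow> 0 \<le> \<theta> \<Longrightarrow> \<theta> < rearrangement x t \<longleftrightarrow> t < distribution_fun x \<theta>"
  using rearrangement_le_iff[of t \<theta>] by linarith

lemma rearrangement_nonneg: "0 < t \<Longrightarrow> 0 \<le> rearrangement x t"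
  unfolding rearrangement_def
  by (rule cInf_greatest) (use distribution_fun_small[of t] in auto)

lemma rearrangement_decreasing:
  assumes "0 < s" "s \<le> t" shows "rearrangement x t \<le> rearrangement x s"
proof -
  have "distribution_fun x (rearrangement x s) \<le> s"
    using rearrangement_le_iff[of s "rearrangement x s"] rearrangement_nonneg[of s] assms by auto
  then show ?thesis
    using rearrangement_le_iff[of t "rearrangement x s"] rearrangement_nonneg[of s] assms by auto
qed

lemma rearrangement_antimono_on: "antimono_on {0<..<1} (rearrangement x)"
  using rearrangement_decreasing by (auto simp: monotone_on_def)

lemma rearrangement_measurable [measurable]: "rearrangement x \<in> borel_measurable leb01"
  by (rule antimono_measurable_leb01[OF rearrangement_antimono_on])

text \<open>By the Galois connection the superlevel set of the rearrangement is, up to the point 0,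
  the interval from 0 to \<open>distribution_fun x \<theta>\<close>.\<close>

lemma distribution_rearrangement:
  assumes "0 \<le> \<theta>"
  shows "distribution_fun (rearrangement x) \<theta> = distribution_fun x \<theta>"
proof -
  have "measure leb01 {s \<in> space leb01. \<theta> < \<bar>rearrangement x s\<bar>} =
      measure leb01 {0<..<distribution_fun x \<theta>}"
  proof (rule measure_eq_AE)
    show "AE s in leb01. s \<in> {s \<in> space leb01. \<theta> < \<bar>rearrangement x s\<bar>} \<longleftrightarrow>
        s \<in> {0<..<distribution_fun x \<theta>}"
      using AE_leb01_pos by eventually_elim (use assms in
        \<open>auto simp: rearrangement_nonneg less_rearrangement_iff space_restrict_space\<close>)
    have "{0<..<distribution_fun x \<theta>} \<subseteq> {0..<1}"
      using distribution_fun_le_1[of x \<theta>] by auto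
    then show "{0<..<distribution_fun x \<theta>} \<in> sets leb01"
      by (auto simp: sets_restrict_space_iff)
  qed measurable
  also have "\<dots> = distribution_fun x \<theta>"
    using emeasure_leb01_ivl[of 0 "distribution_fun x \<theta>"]
    by (simp add: measure_def distribution_fun_le_1 distribution_fun_nonneg)
  finally show ?thesis by (simp add: distribution_fun_alt)
qed

end

text \<open>The superlevel set of \<open>z\<close> at \<open>h v\<close> is that of \<open>x\<close>
  at \<open>v\<close>. As every level \<open>w \<ge> 0\<close> has the form \<open>h v\<close>, the
  Galois connection carries over to all levels. This serves both for \<open>\<phi>\<close> and for
  scaling.\<close>

lemma rearrangement_comp:
  assumes x [measurable]: "x \<in> borel_measurable leb01"
    and h: "strict_mono_on {0..} h" "h ` {0..} = {0..}"
    and z [measurable]: "z \<in> borel_measurable leb01"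
    and zx: "\<And>s. \<bar>z s\<bar> = h \<bar>x s\<bar>" and t: "0 < t"
  shows "rearrangement z t = h (rearrangement x t)"
proof -
  have le_iff: "rearrangement z t \<le> h v \<longleftrightarrow> h (rearrangement x t) \<le> h v" if "0 \<le> v" for v
  proof -
    have hv: "0 \<le> h v" using h(2) that by auto
    have less: "h a < h b \<longleftrightarrow> a < b" if "0 \<le> a" "0 \<le> b" for a b
      using h(1) that strict_mono_on_less by force
    have "distribution_fun z (h v) = distribution_fun x v"
      unfolding distribution_fun_alt zx using less[OF \<open>0 \<le> v\<close>] by simp
    then have "rearrangement z t \<le> h v \<longleftrightarrow> rearrangement x t \<le> v"
      by (simp add: rearrangement_le_iff[OF z t hv] rearrangement_le_iff[OF x t that])
    also have "\<dots> \<longleftrightarrow> h (rearrangement x t) \<le> h v"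
      using less[OF \<open>0 \<le> v\<close> rearrangement_nonneg[OF x t]] by (simp add: not_less[symmetric])
    finally show ?thesis .
  qed
  have "\<exists>v\<ge>0. h v = w" if "0 \<le> w" for w
    using h(2) that by (metis atLeast_iff image_iff)
  then have "rearrangement z t \<le> w \<longleftrightarrow> h (rearrangement x t) \<le> w" if "0 \<le> w" for w
    using le_iff that by metis
  moreover have "0 \<le> h (rearrangement x t)"
    using h(2) rearrangement_nonneg[OF x t] by auto
  moreover have "0 \<le> rearrangement z t"
    using rearrangement_nonneg[OF z t] .
  ultimately show ?thesis by (meson order.antisym order.refl)
qed

section \<open>Integrals of the excess over a level\<close>

text \<open>Layer cake formula, by Fubini on the region
  \<open>c < \<theta> < \<bar>x s\<bar>\<close>. Since \<open>ennreal\<close> maps negative reals to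
  0, the integrand on the left is the positive part of \<open>\<bar>x s\<bar> - c\<close>.\<close>

lemma nn_integral_excess:
  assumes x [measurable]: "x \<in> borel_measurable leb01" and "0 \<le> c"
  shows "(\<integral>\<^sup>+s. ennreal (\<bar>x s\<bar> - c) \<partial>leb01) =
      (\<integral>\<^sup>+\<theta>. indicator {c<..} \<theta> * ennreal (distribution_fun x \<theta>) \<partial>lborel)"
proof -
  interpret pair_sigma_finite leb01 lborel ..
  let ?f = "\<lambda>s \<theta>. if c < \<theta> \<and> \<theta> < \<bar>x s\<bar> then 1 else 0 :: ennreal"
  have 1: "(\<integral>\<^sup>+\<theta>. ?f s \<theta> \<partial>lborel) = ennreal (\<bar>x s\<bar> - c)" for s
  proof -
    have "?f s = indicator {c<..<\<bar>x s\<bar>}" by (auto simp: indicator_def)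
    then show ?thesis by (cases "c \<le> \<bar>x s\<bar>") (auto simp: ennreal_neg)
  qed
  have 2: "(\<integral>\<^sup>+s. ?f s \<theta> \<partial>leb01) = indicator {c<..} \<theta> * ennreal (distribution_fun x \<theta>)" for \<theta>
  proof -
    have "(\<integral>\<^sup>+s. ?f s \<theta> \<partial>leb01) =
        (\<integral>\<^sup>+s. indicator {c<..} \<theta> * indicator {s \<in> space leb01. \<theta> < \<bar>x s\<bar>} s \<partial>leb01)"
      by (rule nn_integral_cong) (auto simp: indicator_def)
    also have "\<dots> = indicator {c<..} \<theta> * emeasure leb01 {s \<in> space leb01. \<theta> < \<bar>x s\<bar>}"
      by (subst nn_integral_cmult_indicator[OF superlevel_sets[OF x]]) simp
    finally show ?thesis
      by (simp add: distribution_fun_alt leb01.emeasure_eq_measure)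
  qed
  have "(\<integral>\<^sup>+\<theta>. (\<integral>\<^sup>+s. ?f s \<theta> \<partial>leb01) \<partial>lborel) = (\<integral>\<^sup>+s. (\<integral>\<^sup>+\<theta>. ?f s \<theta> \<partial>lborel) \<partial>leb01)"
    by (rule Fubini') measurable
  then show ?thesis unfolding 1 2 by simp
qed

lemma nn_integral_excess_rearrangement:
  assumes x [measurable]: "x \<in> borel_measurable leb01" and "0 \<le> c"
  shows "(\<integral>\<^sup>+t. ennreal (rearrangement x t - c) \<partial>leb01) = (\<integral>\<^sup>+s. ennreal (\<bar>x s\<bar> - c) \<partial>leb01)"
proof -
  have "(\<integral>\<^sup>+t. ennreal (rearrangement x t - c) \<partial>leb01) =
      (\<integral>\<^sup>+t. ennreal (\<bar>rearrangement x t\<bar> - c) \<partial>leb01)"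
    using AE_leb01_pos by (intro nn_integral_cong_AE, eventually_elim)
      (simp add: rearrangement_nonneg[OF x])
  also have "\<dots> = (\<integral>\<^sup>+s. ennreal (\<bar>x s\<bar> - c) \<partial>leb01)"
    unfolding nn_integral_excess[OF rearrangement_measurable[OF x] \<open>0 \<le> c\<close>]
      nn_integral_excess[OF x \<open>0 \<le> c\<close>]
    using \<open>0 \<le> c\<close> by (intro nn_integral_cong) (auto simp: indicator_def distribution_rearrangement)
  finally show ?thesis .
qed

text \<open>A monotone function has at most countably many discontinuities. At a continuity point
  \<open>t\<close>, the superlevel set at \<open>g t\<close> lies in \<open>{0..t}\<close>, which
  gives one inequality; were the rearrangement smaller than \<open>g t\<close>, its own superlevel
  set would have measure greater than \<open>t\<close>. Thus a non-increasing function can enter the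
  Orlicz norm as its own rearrangement.\<close>

lemma rearrangement_of_antimono:
  fixes g :: "real \<Rightarrow> real"
  assumes g: "antimono_on {0<..<1} g" and nonneg: "\<And>t. t \<in> {0<..<1} \<Longrightarrow> 0 \<le> g t"
  shows "AE t in leb01. rearrangement g t = g t"
proof -
  have [measurable]: "g \<in> borel_measurable leb01" by (rule antimono_measurable_leb01[OF g])
  define C where "C = {t \<in> {0<..<1}. \<not> isCont (\<lambda>t. - g t) t}"
  have "countable C"
    unfolding C_def by (rule mono_on_ctble_discont_open) (use g in \<open>auto simp: monotone_on_def\<close>)
  then have "AE t in lebesgue. t \<notin> C"
    by (intro AE_completion AE_not_in) (rule countable_imp_null_set_lborel)
  then have "AE t in leb01. t \<notin> C"
    by (subst AE_restrict_space_iff) (auto elim: eventually_mono)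
  then show ?thesis using AE_leb01_pos
  proof eventually_elim
    case (elim t)
    then have t: "0 < t" "t < 1" and cont: "isCont g t"
      using isCont_minus[of t "\<lambda>t. - g t"] by (auto simp: C_def)
    have anti: "g b \<le> g a" if "0 < a" "a \<le> b" "b < 1" for a b
      using g that by (auto simp: monotone_on_def)
    show ?case
    proof (rule antisym)
      have "distribution_fun g (g t) \<le> measure lebesgue {0..t}"
        unfolding distribution_fun_def
      proof (rule measure_mono_fmeasurable)
        show "{s \<in> {0..<1}. g t < \<bar>g s\<bar>} \<subseteq> {0..t}"
          using anti[of t] nonneg t
          by (smt (verit) mem_Collect_eq atLeastLessThan_iff atLeastAtMost_iff
              greaterThanLessThan_iff subsetI)
        have "{s \<in> space leb01. g t < \<bar>g s\<bar>} \<in> sets leb01" by measurable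
        then show "{s \<in> {0..<1}. g t < \<bar>g s\<bar>} \<in> sets lebesgue"
          by (simp add: sets_restrict_space_iff)
      qed auto
      also have "\<dots> = t" using t by simp
      finally show "rearrangement g t \<le> g t"
        using rearrangement_le_iff[of g t "g t"] t nonneg[of t] by simp
    next
      show "g t \<le> rearrangement g t"
      proof (rule ccontr)
        assume "\<not> g t \<le> rearrangement g t"
        then have "eventually (\<lambda>s. rearrangement g t < g s) (at t)"
          using cont by (auto simp: isCont_def intro: order_tendstoD(1))
        then have "eventually (\<lambda>s. rearrangement g t < g s) (at_right t)"
          by (rule filter_leD[rotated]) (simp add: at_le)
        moreover have "eventually (\<lambda>s. s \<in> {t<..<1}) (at_right t)"
          by (rule eventually_at_right_real) (use t in auto)
        ultimately have "eventually (\<lambda>s. rearrangement g t < g s \<and> s \<in> {t<..<1}) (at_right t)"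
          by (rule eventually_conj)
        then obtain s where s: "rearrangement g t < g s" "t < s" "s < 1"
          using eventually_happens'[OF trivial_limit_at_right_real] by auto
        have "ennreal s = emeasure leb01 {0<..<s}"
          using emeasure_leb01_ivl[of 0 s] s t by simp
        also have "\<dots> \<le> emeasure leb01 {r \<in> space leb01. rearrangement g t < \<bar>g r\<bar>}"
          by (rule emeasure_mono)
            (use s anti[of _ s] in \<open>force simp: space_restrict_space\<close>, measurable)
        also have "\<dots> = ennreal (distribution_fun g (rearrangement g t))"
          by (simp add: distribution_fun_alt leb01.emeasure_eq_measure)
        also have "\<dots> \<le> ennreal t"
          using rearrangement_le_iff[of g t "rearrangement g t"] t
          by (intro ennreal_leI) (simp add: rearrangement_nonneg)
        finally show False using s t by (simp add: ennreal_le_iff)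
      qed
    qed
  qed
qed

section \<open>The Lorentz functional\<close>

text \<open>The norm functional of the Lorentz space with weight \<open>\<omega>\<close>. The
  modular of \<open>x\<close> is its value at \<open>\<phi>\<close> composed with \<open>x\<close>,
  see \<open>modular_eq_lorentz\<close>.\<close>

definition lorentz :: "(real \<Rightarrow> real) \<Rightarrow> (real \<Rightarrow> real) \<Rightarrow> ennreal" where
  "lorentz \<omega> x = (\<integral>\<^sup>+t. ennreal (rearrangement x t * \<omega> t) \<partial>leb01)"

section \<open>Rearrangements integrated over an initial segment\<close>

context
  fixes S :: "real set"
  assumes S: "S \<subseteq> {0<..<1}" "S \<in> sets leb01"
    and initial: "\<And>s t. s \<in> S \<Longrightarrow> 0 < t \<Longrightarrow> t \<le> s \<Longrightarrow> t \<in> S"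
begin

text \<open>Together with \<open>segment_integral_attained\<close> this describes the integral over
  \<open>S\<close> as a minimum over levels \<open>c\<close>, a form in which subadditivity is
  visible. The rearrangement is split pointwise at \<open>c\<close>, and its excess has the same
  integral as that of \<open>x\<close>.\<close>

lemma segment_integral_le:
  assumes x: "x \<in> borel_measurable leb01" and c: "0 \<le> c"
  shows "(\<integral>\<^sup>+t. ennreal (rearrangement x t) * indicator S t \<partial>leb01) \<le>
      ennreal c * emeasure leb01 S + (\<integral>\<^sup>+s. ennreal (\<bar>x s\<bar> - c) \<partial>leb01)"
proof -
  note [measurable] = S(2) rearrangement_measurable[OF x]
  have "(\<integral>\<^sup>+t. ennreal (rearrangement x t) * indicator S t \<partial>leb01) \<le>
      (\<integral>\<^sup>+t. ennreal c * indicator S t + ennreal (rearrangement x t - c) \<partial>leb01)"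
  proof (rule nn_integral_mono)
    fix t
    have "ennreal (rearrangement x t) \<le> ennreal c + ennreal (rearrangement x t - c)"
      using c by (cases "c \<le> rearrangement x t")
        (auto simp: ennreal_plus[symmetric] ennreal_neg simp del: ennreal_plus intro: ennreal_leI)
    then show "ennreal (rearrangement x t) * indicator S t \<le>
        ennreal c * indicator S t + ennreal (rearrangement x t - c)"
      by (auto simp: indicator_def)
  qed
  also have "\<dots> = ennreal c * emeasure leb01 S + (\<integral>\<^sup>+s. ennreal (\<bar>x s\<bar> - c) \<partial>leb01)"
    by (subst nn_integral_add)
      (auto simp: nn_integral_cmult_indicator[OF S(2)] nn_integral_excess_rearrangement[OF x c])
  finally show ?thesis .
qed

text \<open>A suitable \<open>c\<close> separates the values of the rearrangement on
  \<open>S\<close> from those beyond \<open>S\<close>: on \<open>S\<close> the pointwise splitting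
  is then exact, and outside \<open>S\<close> the excess vanishes.\<close>

lemma segment_integral_attained:
  assumes x: "x \<in> borel_measurable leb01" and ne: "S \<noteq> {}"
  obtains c where "0 \<le> c"
    "(\<integral>\<^sup>+t. ennreal (rearrangement x t) * indicator S t \<partial>leb01) =
      ennreal c * emeasure leb01 S + (\<integral>\<^sup>+s. ennreal (\<bar>x s\<bar> - c) \<partial>leb01)"
proof -
  obtain s0 where s0: "s0 \<in> S" using ne by auto
  note [measurable] = S(2) rearrangement_measurable[OF x]
  define R where "R = rearrangement x ` ({0<..<1} - S)"
  \<comment> \<open>If \<open>S\<close> is the whole open interval, there are no values beyond it,
    and \<open>c = 0\<close> works because the rearrangement is nonnegative.\<close>
  define c where "c = (if R = {} then 0 else Sup R)"
  have below: "t < s" if "t \<in> S" "s \<in> {0<..<1} - S" for s t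
    using initial[OF that(1), of s] that by (auto simp: not_le[symmetric])
  have R_le: "r \<le> rearrangement x t" if tr: "t \<in> S" "r \<in> R" for r t
  proof -
    obtain s where s: "s \<in> {0<..<1} - S" "r = rearrangement x s"
      using tr(2) by (auto simp: R_def)
    have "0 < t" using tr(1) S(1) by auto
    then show ?thesis
      using rearrangement_decreasing[OF x, of t s] below[OF tr(1) s(1)] s(2) by simp
  qed
  have bdd: "bdd_above R" by (rule bdd_aboveI[OF R_le[OF s0]])
  have c_le: "c \<le> rearrangement x t" if "t \<in> S" for t
  proof -
    have "0 < t" using that S(1) by auto
    then show ?thesis
      using rearrangement_nonneg[OF x, of t] R_le[OF that] by (simp add: c_def cSup_least)
  qed
  have c_ge: "rearrangement x t \<le> c" if "t \<in> {0<..<1} - S" for t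
  proof -
    have "rearrangement x t \<in> R" using that by (auto simp: R_def)
    then show ?thesis using bdd by (auto simp: c_def intro: cSup_upper)
  qed
  have c0: "0 \<le> c"
  proof (cases "R = {}")
    case R: False
    then obtain t where "t \<in> {0<..<1} - S" unfolding R_def by blast
    then show ?thesis using c_ge[of t] rearrangement_nonneg[OF x, of t] by auto
  qed (simp add: c_def)
  have "ennreal c * emeasure leb01 S + (\<integral>\<^sup>+s. ennreal (\<bar>x s\<bar> - c) \<partial>leb01) =
      (\<integral>\<^sup>+t. ennreal c * indicator S t + ennreal (rearrangement x t - c) \<partial>leb01)"
    by (subst nn_integral_add)
      (auto simp: nn_integral_cmult_indicator[OF S(2)] nn_integral_excess_rearrangement[OF x c0])
  also have "\<dots> = (\<integral>\<^sup>+t. ennreal (rearrangement x t) * indicator S t \<partial>leb01)"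
    using AE_leb01_pos
  proof (intro nn_integral_cong_AE, eventually_elim)
    case (elim t)
    then show ?case using c_le[of t] c_ge[of t] c0
      by (cases "t \<in> S")
        (auto simp: ennreal_plus[symmetric] ennreal_neg simp del: ennreal_plus)
  qed
  finally show ?thesis using that c0 by simp
qed

text \<open>The optimal levels \<open>a\<close> for \<open>x\<close> and \<open>b\<close> for
  \<open>y\<close> add up to a level for \<open>z\<close>: the positive part of
  \<open>\<bar>z s\<bar> - (a + b)\<close> is at most the sum of the positive parts of
  \<open>\<bar>x s\<bar> - a\<close> and \<open>\<bar>y s\<bar> - b\<close>.\<close>

lemma segment_integral_subadditive:
  assumes x [measurable]: "x \<in> borel_measurable leb01" and y [measurable]: "y \<in> borel_measurable leb01"
    and z: "z \<in> borel_measurable leb01" and zxy: "\<And>s. \<bar>z s\<bar> \<le> \<bar>x s\<bar> + \<bar>y s\<bar>"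
  shows "(\<integral>\<^sup>+t. ennreal (rearrangement z t) * indicator S t \<partial>leb01) \<le>
      (\<integral>\<^sup>+t. ennreal (rearrangement x t) * indicator S t \<partial>leb01) +
      (\<integral>\<^sup>+t. ennreal (rearrangement y t) * indicator S t \<partial>leb01)"
proof (cases "S = {}")
  case False
  obtain a where a: "0 \<le> a" "(\<integral>\<^sup>+t. ennreal (rearrangement x t) * indicator S t \<partial>leb01) =
      ennreal a * emeasure leb01 S + (\<integral>\<^sup>+s. ennreal (\<bar>x s\<bar> - a) \<partial>leb01)"
    using segment_integral_attained[OF x False] .
  obtain b where b: "0 \<le> b" "(\<integral>\<^sup>+t. ennreal (rearrangement y t) * indicator S t \<partial>leb01) =
      ennreal b * emeasure leb01 S + (\<integral>\<^sup>+s. ennreal (\<bar>y s\<bar> - b) \<partial>leb01)"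
    using segment_integral_attained[OF y False] .
  have "(\<integral>\<^sup>+s. ennreal (\<bar>z s\<bar> - (a + b)) \<partial>leb01) \<le>
      (\<integral>\<^sup>+s. ennreal (\<bar>x s\<bar> - a) + ennreal (\<bar>y s\<bar> - b) \<partial>leb01)"
  proof (rule nn_integral_mono)
    fix s
    have "ennreal (\<bar>z s\<bar> - (a + b)) \<le> ennreal (max 0 (\<bar>x s\<bar> - a) + max 0 (\<bar>y s\<bar> - b))"
      using zxy[of s] by (intro ennreal_leI) linarith
    then show "ennreal (\<bar>z s\<bar> - (a + b)) \<le> ennreal (\<bar>x s\<bar> - a) + ennreal (\<bar>y s\<bar> - b)"
      by (simp add: ennreal_max_0)
  qed
  also have "\<dots> = (\<integral>\<^sup>+s. ennreal (\<bar>x s\<bar> - a) \<partial>leb01) + (\<integral>\<^sup>+s. ennreal (\<bar>y s\<bar> - b) \<partial>leb01)"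
    by (rule nn_integral_add) auto
  finally have "ennreal (a + b) * emeasure leb01 S + (\<integral>\<^sup>+s. ennreal (\<bar>z s\<bar> - (a + b)) \<partial>leb01) \<le>
      (ennreal a * emeasure leb01 S + (\<integral>\<^sup>+s. ennreal (\<bar>x s\<bar> - a) \<partial>leb01)) +
      (ennreal b * emeasure leb01 S + (\<integral>\<^sup>+s. ennreal (\<bar>y s\<bar> - b) \<partial>leb01))"
    using a(1) b(1) by (simp add: distrib_right add.assoc add.left_commute add_left_mono)
  then show ?thesis
    using segment_integral_le[OF z, of "a + b"] a b by (auto intro: order_trans)
qed simp

end

section \<open>Weights and the triangle inequality for the Lorentz functional\<close>

context
  fixes \<omega> :: "real \<Rightarrow> real"
  assumes weight: "weight_function \<omega>"
begin

lemma weight_nonneg: "0 \<le> t \<Longrightarrow> t < 1 \<Longrightarrow> 0 \<le> \<omega> t"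
  using weight by (simp add: weight_function_def)

lemma weight_decreasing: "0 < s \<Longrightarrow> s \<le> t \<Longrightarrow> t < 1 \<Longrightarrow> \<omega> t \<le> \<omega> s"
  using weight by (auto simp: weight_function_def monotone_on_def)

lemma weight_measurable: "\<omega> \<in> borel_measurable leb01"
  using weight by (auto simp: weight_function_def intro: antimono_measurable_leb01)

text \<open>Near 0 the weight is integrable by hypothesis, and beyond 1/2 it is bounded by
  \<open>\<omega> (1/2)\<close>.\<close>

lemma weight_integral_finite: "(\<integral>\<^sup>+t. ennreal (\<omega> t) \<partial>leb01) < \<infinity>"
proof -
  have int: "integrable lebesgue (\<lambda>t. indicator {0..1/2} t *\<^sub>R \<omega> t)"
    using weight by (auto simp: weight_function_def set_integrable_def)
  have "(\<integral>\<^sup>+t. ennreal (\<omega> t) \<partial>leb01) = (\<integral>\<^sup>+t. ennreal (\<omega> t) * indicator {0..<1} t \<partial>lebesgue)"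
    by (rule nn_integral_restrict_space) simp
  also have "\<dots> \<le> (\<integral>\<^sup>+t. ennreal (norm (indicator {0..1/2} t *\<^sub>R \<omega> t)) +
      ennreal (\<omega> (1/2)) * indicator {0..<1} t \<partial>lebesgue)"
  proof (rule nn_integral_mono)
    fix t
    show "ennreal (\<omega> t) * indicator {0..<1} t \<le>
        ennreal (norm (indicator {0..1/2} t *\<^sub>R \<omega> t)) + ennreal (\<omega> (1/2)) * indicator {0..<1} t"
    proof (cases "t \<in> {0..<1} \<and> t > 1/2")
      case True
      then show ?thesis using weight_decreasing[of "1/2" t] by (auto intro: ennreal_leI)
    next
      case False
      then show ?thesis using weight_nonneg[of t]
        by (auto simp: indicator_def split: if_splits)
    qed
  qed
  also have "\<dots> = (\<integral>\<^sup>+t. ennreal (norm (indicator {0..1/2} t *\<^sub>R \<omega> t)) \<partial>lebesgue) + ennreal (\<omega> (1/2))"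
  proof (subst nn_integral_add)
    show "(\<lambda>t. ennreal (norm (indicator {0..1/2} t *\<^sub>R \<omega> t))) \<in> borel_measurable lebesgue"
      using int by measurable
    show "(\<lambda>t::real. ennreal (\<omega> (1/2)) * indicator {0..<1} t) \<in> borel_measurable lebesgue"
      by (intro borel_measurable_times_ennreal borel_measurable_const borel_measurable_indicator) simp
  qed (simp add: nn_integral_cmult_indicator)
  also have "\<dots> < \<infinity>"
    using int unfolding integrable_iff_bounded by simp
  finally show ?thesis .
qed

lemma weight_pos:
  assumes ne: "{t \<in> {0..<1}. 0 < \<omega> t} \<noteq> {}" and t: "0 < t" "t < Sup {t \<in> {0..<1}. 0 < \<omega> t}"
  shows "0 < \<omega> t"
proof -
  obtain s where "s \<in> {t \<in> {0..<1}. 0 < \<omega> t}" "t < s"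
    using less_cSupE[OF t(2) ne] .
  then show ?thesis using weight_decreasing[of t s] t by auto
qed

lemma weight_zero:
  assumes "Sup {t \<in> {0..<1}. 0 < \<omega> t} < t" "0 \<le> t" "t < 1" shows "\<omega> t = 0"
proof (rule ccontr)
  assume "\<omega> t \<noteq> 0"
  then have "t \<in> {t \<in> {0..<1}. 0 < \<omega> t}" using weight_nonneg[of t] assms by auto
  then have "t \<le> Sup {t \<in> {0..<1}. 0 < \<omega> t}"
    by (rule cSup_upper) (auto intro!: bdd_aboveI[of _ 1])
  then show False using assms by simp
qed

text \<open>Write \<open>\<omega> t\<close> as the length of the set of \<open>r\<close> with
  \<open>0 < r < \<omega> t\<close>. By Fubini the functional becomes an integral over
  \<open>r\<close> of segment integrals over the superlevel sets \<open>S r\<close> of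
  \<open>\<omega>\<close>, which are initial segments because \<open>\<omega>\<close> is
  non-increasing.\<close>

lemma lorentz_subadditive:
  assumes x: "x \<in> borel_measurable leb01" and y: "y \<in> borel_measurable leb01"
    and z: "z \<in> borel_measurable leb01" and zxy: "\<And>s. \<bar>z s\<bar> \<le> \<bar>x s\<bar> + \<bar>y s\<bar>"
  shows "lorentz \<omega> z \<le> lorentz \<omega> x + lorentz \<omega> y"
proof -
  interpret pair_sigma_finite leb01 lborel ..
  note [measurable] = weight_measurable
  \<comment> \<open>\<open>0 < t\<close> confines \<open>S r\<close> to the open interval, where
    \<open>\<omega>\<close> is monotone.\<close>
  define S where "S r = {t \<in> space leb01. 0 < t \<and> 0 < r \<and> r < \<omega> t}" for r
  have [measurable]: "(\<lambda>t. t) \<in> borel_measurable leb01"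
    by (intro measurable_restrict_space1 measurable_completion) simp
  have S_sets [measurable]: "S r \<in> sets leb01" for r
    unfolding S_def by measurable
  have S: "S r \<subseteq> {0<..<1}" for r by (auto simp: S_def)
  have S_initial: "t \<in> S r" if "s \<in> S r" "0 < t" "t \<le> s" for r s t
    using that weight_decreasing[of t s] by (auto simp: S_def)
  let ?I = "\<lambda>x r. \<integral>\<^sup>+t. ennreal (rearrangement x t) * indicator (S r) t \<partial>leb01"
  have layer: "lorentz \<omega> x = (\<integral>\<^sup>+r. ?I x r \<partial>lborel)" and
    meas: "?I x \<in> borel_measurable lborel"
    if x: "x \<in> borel_measurable leb01" for x
  proof -
    note [measurable] = rearrangement_measurable[OF x]
    let ?f = "\<lambda>t r. ennreal (rearrangement x t) * (if 0 < t \<and> 0 < r \<and> r < \<omega> t then 1 else 0)"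
    have f_meas: "case_prod ?f \<in> borel_measurable (leb01 \<Otimes>\<^sub>M lborel)" by measurable
    have I: "?I x r = (\<integral>\<^sup>+t. ?f t r \<partial>leb01)" for r
      by (rule nn_integral_cong) (auto simp: S_def indicator_def)
    show "?I x \<in> borel_measurable lborel" unfolding I by measurable
    have "lorentz \<omega> x = (\<integral>\<^sup>+t. (\<integral>\<^sup>+r. ?f t r \<partial>lborel) \<partial>leb01)"
      unfolding lorentz_def using AE_leb01_pos
    proof (intro nn_integral_cong_AE, eventually_elim)
      case (elim t)
      have "(\<integral>\<^sup>+r. ?f t r \<partial>lborel) = (\<integral>\<^sup>+r. ennreal (rearrangement x t) * indicator {0<..<\<omega> t} r \<partial>lborel)"
        using elim by (intro nn_integral_cong) (auto simp: indicator_def)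
      also have "\<dots> = ennreal (rearrangement x t) * ennreal (\<omega> t)"
        using elim weight_nonneg[of t] by (simp add: nn_integral_cmult_indicator)
      finally show ?case
        using elim weight_nonneg[of t] rearrangement_nonneg[OF x, of t] by (simp add: ennreal_mult)
    qed
    also have "\<dots> = (\<integral>\<^sup>+r. (\<integral>\<^sup>+t. ?f t r \<partial>leb01) \<partial>lborel)"
      by (rule Fubini'[symmetric, OF f_meas])
    finally show "lorentz \<omega> x = (\<integral>\<^sup>+r. ?I x r \<partial>lborel)" unfolding I .
  qed
  have "lorentz \<omega> z \<le> (\<integral>\<^sup>+r. ?I x r + ?I y r \<partial>lborel)"
    unfolding layer[OF z]
    by (intro nn_integral_mono segment_integral_subadditive[OF S S_sets S_initial x y z zxy])
  then show ?thesis
    unfolding layer[OF x] layer[OF y] using meas[OF x] meas[OF y] by (simp add: nn_integral_add)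
qed


section \<open>Equality in the monotonicity of the Lorentz functional\<close>

text \<open>The integrand for \<open>F\<close> is at most that for \<open>G\<close>; as the
  integrals are equal and finite, the integrands agree almost everywhere, so the rearrangements
  agree almost everywhere on \<open>(0, \<alpha>)\<close>. A violation at \<open>\<theta>\<close>
  would produce an interval \<open>J\<close> on which the rearrangement of \<open>F\<close> is at
  most \<open>\<theta>\<close> while that of \<open>G\<close> exceeds it.\<close>

lemma distribution_ge_of_lorentz_eq:
  assumes pos: "\<forall>t. 0 < t \<longrightarrow> t < \<alpha> \<longrightarrow> 0 < \<omega> t"
    and F: "F \<in> borel_measurable leb01" and G: "G \<in> borel_measurable leb01"
    and FG: "\<And>s. \<bar>F s\<bar> \<le> \<bar>G s\<bar>"
    and le: "lorentz \<omega> G \<le> lorentz \<omega> F" and fin: "lorentz \<omega> G < \<infinity>" and "0 \<le> \<theta>"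
  shows "min (\<alpha>) (distribution_fun G \<theta>) \<le> distribution_fun F \<theta>"
proof (rule ccontr)
  note [measurable] = weight_measurable rearrangement_measurable[OF F] rearrangement_measurable[OF G]
  have dFG: "distribution_fun F \<eta> \<le> distribution_fun G \<eta>" for \<eta>
    unfolding distribution_fun_alt
    by (rule leb01.finite_measure_mono[OF _ superlevel_sets[OF G]])
      (auto intro: order.strict_trans2[OF _ FG])
  have rFG: "rearrangement F t \<le> rearrangement G t" if "0 < t" for t
    using rearrangement_le_iff[OF G that, of "rearrangement G t"] dFG[of "rearrangement G t"]
      rearrangement_le_iff[OF F that, of "rearrangement G t"] rearrangement_nonneg[OF G that]
    by auto
  have AE_le: "AE t in leb01. ennreal (rearrangement G t * \<omega> t) \<le> ennreal (rearrangement F t * \<omega> t)"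
  proof (rule ccontr)
    assume not: "\<not> ?thesis"
    have AE_ge: "AE t in leb01. ennreal (rearrangement F t * \<omega> t) \<le> ennreal (rearrangement G t * \<omega> t)"
      using AE_leb01_pos
      by eventually_elim (auto intro!: ennreal_leI mult_right_mono rFG weight_nonneg)
    have "lorentz \<omega> F \<le> lorentz \<omega> G"
      unfolding lorentz_def by (rule nn_integral_mono_AE[OF AE_ge])
    then have "lorentz \<omega> F \<noteq> \<infinity>" using fin by auto
    then have "lorentz \<omega> F < lorentz \<omega> G"
      unfolding lorentz_def by (intro nn_integral_less AE_ge not) auto
    then show False using le by simp
  qed
  assume "\<not> min \<alpha> (distribution_fun G \<theta>) \<le> distribution_fun F \<theta>"
  then have less: "distribution_fun F \<theta> < min \<alpha> (distribution_fun G \<theta>)"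
    by (simp only: not_le)
  define J where "J = {distribution_fun F \<theta><..<min \<alpha> (distribution_fun G \<theta>)}"
  have em: "emeasure leb01 J = ennreal (min \<alpha> (distribution_fun G \<theta>) - distribution_fun F \<theta>)"
    unfolding J_def
  proof (rule emeasure_leb01_ivl)
    show "min \<alpha> (distribution_fun G \<theta>) \<le> 1"
      using distribution_fun_le_1[of G \<theta>] by linarith
  qed (use less in \<open>simp_all only: less_imp_le distribution_fun_nonneg\<close>)
  have "AE t in leb01. t \<notin> J"
    using AE_le AE_leb01_pos
  proof eventually_elim
    case (elim t)
    show ?case
    proof
      assume "t \<in> J"
      then have t: "distribution_fun F \<theta> < t" "t < \<alpha>" "t < distribution_fun G \<theta>"
        by (auto simp: J_def)
      have "rearrangement F t \<le> \<theta>" "\<theta> < rearrangement G t"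
        using rearrangement_le_iff[OF F _ \<open>0 \<le> \<theta>\<close>, of t] less_rearrangement_iff[OF G _ \<open>0 \<le> \<theta>\<close>, of t]
          elim t by simp_all
      moreover have "0 < \<omega> t" using pos elim t by auto
      ultimately show False
        using elim \<open>0 \<le> \<theta>\<close> by (simp add: ennreal_le_iff2 mult_le_0_iff)
    qed
  qed
  moreover have "J \<in> sets leb01"
  proof -
    have "J \<subseteq> {0..<1}"
      using distribution_fun_le_1[of G \<theta>] distribution_fun_nonneg[of F \<theta>] by (auto simp: J_def)
    then show ?thesis by (auto simp: sets_restrict_space_iff J_def)
  qed
  ultimately have "emeasure leb01 J = 0"
    using AE_iff_null_sets[of J leb01] by auto
  then show False using em less by auto
qed

text \<open>From the level \<open>c = rearrangement G \<beta>\<close> on, the distribution function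
  of \<open>G\<close> is at most \<open>\<beta> < \<alpha>\<close>, so it coincides with that of
  \<open>F\<close>, and the superlevel sets differ by null sets. Below \<open>c\<close> the
  distribution function of \<open>G\<close> exceeds \<open>\<beta>\<close>, so that of
  \<open>F\<close> is at least \<open>\<beta>\<close>; letting the level rise to \<open>c\<close>
  gives the second claim.\<close>

lemma AE_eq_of_lorentz_eq:
  assumes pos: "\<forall>t. 0 < t \<longrightarrow> t < \<alpha> \<longrightarrow> 0 < \<omega> t"
    and F: "F \<in> borel_measurable leb01" and G: "G \<in> borel_measurable leb01"
    and FG: "\<And>s. \<bar>F s\<bar> \<le> \<bar>G s\<bar>"
    and le: "lorentz \<omega> G \<le> lorentz \<omega> F" and fin: "lorentz \<omega> G < \<infinity>"
    and \<beta>: "0 < \<beta>" "\<beta> < \<alpha>" "\<beta> \<le> 1"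
  shows "AE s in leb01. rearrangement G \<beta> \<le> \<bar>F s\<bar> \<longrightarrow> \<bar>F s\<bar> = \<bar>G s\<bar>"
    and "\<beta> \<le> measure leb01 {s \<in> space leb01. rearrangement G \<beta> \<le> \<bar>F s\<bar>}"
proof -
  note [measurable] = F G
  define c where "c = rearrangement G \<beta>"
  have c0: "0 \<le> c" unfolding c_def by (rule rearrangement_nonneg[OF G \<beta>(1)])
  note dist = distribution_ge_of_lorentz_eq[OF pos F G FG le fin]
  \<comment> \<open>Rational levels suffice to detect
    \<open>\<bar>F s\<bar> < \<bar>G s\<bar>\<close>, and countably many null sets form a null
    set.\<close>
  have "AE s in leb01. \<forall>q::rat. \<not> (c \<le> of_rat q \<and> \<bar>F s\<bar> \<le> of_rat q \<and> of_rat q < \<bar>G s\<bar>)"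
  proof (subst AE_all_countable, rule allI)
    fix q :: rat
    let ?q = "of_rat q :: real"
    show "AE s in leb01. \<not> (c \<le> ?q \<and> \<bar>F s\<bar> \<le> ?q \<and> ?q < \<bar>G s\<bar>)"
    proof (cases "c \<le> ?q")
      case True
      then have "0 \<le> ?q" using c0 by (rule order_trans[rotated])
      then have "distribution_fun G ?q \<le> \<beta>"
        using rearrangement_le_iff[OF G \<beta>(1), of ?q] True unfolding c_def by blast
      then have "distribution_fun G ?q \<le> distribution_fun F ?q"
        using dist[OF \<open>0 \<le> ?q\<close>] \<beta> by linarith
      moreover define D where "D = {s \<in> space leb01. ?q < \<bar>G s\<bar>} - {s \<in> space leb01. ?q < \<bar>F s\<bar>}"
      moreover have "measure leb01 D = distribution_fun G ?q - distribution_fun F ?q"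
        unfolding D_def distribution_fun_alt
        by (rule leb01.finite_measure_Diff[OF superlevel_sets[OF G] superlevel_sets[OF F]])
          (auto intro: order.strict_trans2[OF _ FG])
      ultimately have "measure leb01 D = 0"
        using measure_nonneg[of leb01 D] by linarith
      moreover have "D \<in> sets leb01"
        unfolding D_def by (rule sets.Diff[OF superlevel_sets[OF G] superlevel_sets[OF F]])
      ultimately have "D \<in> null_sets leb01"
        by (simp add: null_sets_def leb01.emeasure_eq_measure)
      from AE_not_in[OF this] show ?thesis using AE_space
        by eventually_elim (simp add: D_def, linarith)
    qed simp
  qed
  then show "AE s in leb01. rearrangement G \<beta> \<le> \<bar>F s\<bar> \<longrightarrow> \<bar>F s\<bar> = \<bar>G s\<bar>"
  proof eventually_elim
    case (elim s)
    show ?case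
    proof (rule impI, rule ccontr)
      assume "rearrangement G \<beta> \<le> \<bar>F s\<bar>" "\<bar>F s\<bar> \<noteq> \<bar>G s\<bar>"
      then have "\<bar>F s\<bar> < \<bar>G s\<bar>" using FG[of s] by linarith
      then obtain q where q: "\<bar>F s\<bar> < of_rat q" "of_rat q < \<bar>G s\<bar>"
        using of_rat_dense by blast
      have "c \<le> of_rat q"
        using \<open>rearrangement G \<beta> \<le> \<bar>F s\<bar>\<close> q(1) by (simp add: c_def)
      with q spec[OF elim, of q] show False by simp
    qed
  qed
  define A where "A n = {s \<in> space leb01. c - 1 / real (Suc n) < \<bar>F s\<bar>}" for n
  have "(\<lambda>n. measure leb01 (A n)) \<longlonglongrightarrow> measure leb01 (\<Inter>n. A n)"
  proof (rule leb01.finite_Lim_measure_decseq)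
    show "range A \<subseteq> sets leb01" unfolding A_def using superlevel_sets[OF F] by blast
    show "decseq A"
      unfolding decseq_def A_def
    proof (intro allI impI subsetI)
      fix m n s assume "m \<le> n" and s: "s \<in> {s \<in> space leb01. c - 1 / real (Suc n) < \<bar>F s\<bar>}"
      then have "1 / real (Suc n) \<le> 1 / real (Suc m)" by (intro divide_left_mono) auto
      then show "s \<in> {s \<in> space leb01. c - 1 / real (Suc m) < \<bar>F s\<bar>}"
        using s by auto
    qed
  qed
  moreover have "(\<Inter>n. A n) = {s \<in> space leb01. c \<le> \<bar>F s\<bar>}"
  proof (intro equalityI subsetI)
    fix s assume s: "s \<in> (\<Inter>n. A n)"
    have "c \<le> \<bar>F s\<bar>"
    proof (rule ccontr)
      assume "\<not> c \<le> \<bar>F s\<bar>"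
      then obtain n where "inverse (real (Suc n)) < c - \<bar>F s\<bar>"
        using reals_Archimedean[of "c - \<bar>F s\<bar>"] by auto
      moreover have "c - 1 / real (Suc n) < \<bar>F s\<bar>" using s by (auto simp: A_def)
      ultimately show False by (simp add: inverse_eq_divide)
    qed
    then show "s \<in> {s \<in> space leb01. c \<le> \<bar>F s\<bar>}" using s by (auto simp: A_def)
  next
    fix s assume s: "s \<in> {s \<in> space leb01. c \<le> \<bar>F s\<bar>}"
    have "c - 1 / real (Suc n) < c" for n by simp
    then have "c - 1 / real (Suc n) < \<bar>F s\<bar>" for n
      using s by (blast intro: order.strict_trans2)
    then show "s \<in> (\<Inter>n. A n)" using s by (simp add: A_def)
  qed
  \<comment> \<open>The facts on distribution functions concern nonnegative levels; for a negative
    level \<open>A n\<close> is the whole space.\<close>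
  moreover have "\<beta> \<le> measure leb01 (A n)" for n
  proof (cases "c - 1 / real (Suc n) < 0")
    case True
    then have "A n = space leb01" by (auto simp: A_def intro: order.strict_trans2[OF _ abs_ge_zero])
    then show ?thesis using \<beta> by (simp add: measure_restrict_space)
  next
    case False
    define \<theta> where "\<theta> = c - 1 / real (Suc n)"
    have \<theta>: "0 \<le> \<theta>" "\<theta> < c" using False by (simp_all add: \<theta>_def)
    then have "\<beta> < distribution_fun G \<theta>"
      using less_rearrangement_iff[OF G \<beta>(1) \<theta>(1)] by (simp add: c_def)
    then have "\<beta> \<le> distribution_fun F \<theta>"
      using dist[OF \<theta>(1)] \<beta>(2) by linarith
    then show ?thesis by (simp add: A_def distribution_fun_alt \<theta>_def)
  qed
  ultimately show "\<beta> \<le> measure leb01 {s \<in> space leb01. rearrangement G \<beta> \<le> \<bar>F s\<bar>}"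
    by (auto simp: c_def intro: LIMSEQ_le_const)
qed

text \<open>Both \<open>F\<close> and \<open>F'\<close> agree with \<open>G\<close> on sets of measure greater than 1/2, which must meet.\<close>
lemma AE_zero_of_lorentz_eq:
  assumes half: "1/2 < \<alpha>" and pos: "\<forall>t. 0 < t \<longrightarrow> t < \<alpha> \<longrightarrow> 0 < \<omega> t"
    and F: "F \<in> borel_measurable leb01" and F': "F' \<in> borel_measurable leb01"
    and G: "G \<in> borel_measurable leb01"
    and FG: "\<And>s. \<bar>F s\<bar> \<le> \<bar>G s\<bar>" "\<And>s. \<bar>F' s\<bar> \<le> \<bar>G s\<bar>"
    and le: "lorentz \<omega> G \<le> lorentz \<omega> F" "lorentz \<omega> G \<le> lorentz \<omega> F'"
    and fin: "lorentz \<omega> G < \<infinity>"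
    and strict: "\<And>s. G s \<noteq> 0 \<Longrightarrow> \<bar>F s\<bar> < \<bar>G s\<bar> \<or> \<bar>F' s\<bar> < \<bar>G s\<bar>"
  shows "AE s in leb01. G s = 0"
proof -
  note [measurable] = F F' G
  \<comment> \<open>Two sets of measure at least \<open>\<beta> > 1/2\<close> cannot be disjoint in
    the unit interval, and \<open>\<beta> < \<alpha>\<close> is what
    \<open>AE_eq_of_lorentz_eq\<close> asks for.\<close>
  obtain \<beta> where "1/2 < \<beta>" "\<beta> < min 1 \<alpha>"
    using dense[of "1/2" "min 1 \<alpha>"] half by auto
  then have \<beta>: "0 < \<beta>" "\<beta> < \<alpha>" "\<beta> \<le> 1" "1/2 < \<beta>" by auto
  define c where "c = rearrangement G \<beta>"
  define A where "A = {s \<in> space leb01. c \<le> \<bar>F s\<bar>}"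
  define A' where "A' = {s \<in> space leb01. c \<le> \<bar>F' s\<bar>}"
  have sets: "A \<in> sets leb01" "A' \<in> sets leb01" unfolding A_def A'_def by measurable
  note eqF = AE_eq_of_lorentz_eq[OF pos F G FG(1) le(1) fin \<beta>(1-3), folded c_def, folded A_def]
  note eqF' = AE_eq_of_lorentz_eq[OF pos F' G FG(2) le(2) fin \<beta>(1-3), folded c_def, folded A'_def]
  have zero: "AE s in leb01. c \<le> \<bar>F s\<bar> \<and> c \<le> \<bar>F' s\<bar> \<longrightarrow> G s = 0"
    using eqF(1) eqF'(1) by eventually_elim (use strict in fastforce)
  \<comment> \<open>If \<open>c \<le> 0\<close>, the premise of \<open>zero\<close> always holds. If
    \<open>c > 0\<close>, a common point of \<open>A\<close> and \<open>A'\<close> has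
    \<open>0 < c \<le> \<bar>F s\<bar> \<le> \<bar>G s\<bar>\<close>, so by \<open>zero\<close> the
    two sets are disjoint up to a null set, and their measures add up to more than 1.\<close>
  show ?thesis
  proof (cases "c \<le> 0")
    case True
    from zero show ?thesis
      by eventually_elim (use True in \<open>auto intro: order_trans\<close>)
  next
    case False
    have "AE s in leb01. s \<in> A' - A \<longleftrightarrow> s \<in> A'"
      using zero
    proof eventually_elim
      case (elim s)
      then show ?case using False FG(1)[of s] by (auto simp: A_def A'_def)
    qed
    then have "measure leb01 (A' - A) = measure leb01 A'"
      by (rule measure_eq_AE) (use sets in auto)
    then have "measure leb01 A + measure leb01 A' = measure leb01 (A \<union> A')"
      using leb01.finite_measure_Union'[OF sets] by simp
    also have "\<dots> \<le> measure leb01 (space leb01)" by (rule leb01.bounded_measure)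
    also have "\<dots> = 1" by (simp add: measure_restrict_space)
    finally show ?thesis using eqF(2) eqF'(2) \<beta> by simp
  qed
qed

end

section \<open>The Orlicz norm\<close>

lemma rearrangement_scale:
  assumes x: "x \<in> borel_measurable leb01" and c: "0 < c" and t: "0 < t"
  shows "rearrangement (\<lambda>s. c * x s) t = c * rearrangement x t"
proof (rule rearrangement_comp[OF x, where h = "\<lambda>u. c * u"])
  show "strict_mono_on {0..} (\<lambda>u. c * u)" using c by (auto intro!: strict_mono_onI)
  have "v \<in> (\<lambda>u. c * u) ` {0..}" if "0 \<le> v" for v
    using that c by (intro image_eqI[of _ _ "v / c"]) auto
  then show "(\<lambda>u. c * u) ` {0..} = {0..}" using c by auto
qed (use x c t in \<open>auto simp: abs_mult\<close>)

lemma lorentz_scale: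
  assumes weight: "weight_function \<omega>" and x: "x \<in> borel_measurable leb01" and c: "0 < c"
  shows "lorentz \<omega> (\<lambda>s. c * x s) = ennreal c * lorentz \<omega> x"
proof -
  note [measurable] = weight_measurable[OF weight] rearrangement_measurable[OF x]
  have "lorentz \<omega> (\<lambda>s. c * x s) = (\<integral>\<^sup>+t. ennreal c * ennreal (rearrangement x t * \<omega> t) \<partial>leb01)"
    unfolding lorentz_def using AE_leb01_pos
    by (intro nn_integral_cong_AE, eventually_elim)
      (use c in \<open>simp add: rearrangement_scale[OF x] ennreal_mult'[symmetric] mult.assoc\<close>)
  then show ?thesis by (simp add: nn_integral_cmult lorentz_def)
qed

lemma rearrangement_le_bound:
  assumes "z \<in> borel_measurable leb01" "\<And>s. \<bar>z s\<bar> \<le> c" "0 < t"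
  shows "rearrangement z t \<le> c"
proof -
  have "{s \<in> space leb01. c < \<bar>z s\<bar>} = {}" using assms(2) by (auto simp: not_less)
  then have "distribution_fun z c = 0" by (simp only: distribution_fun_alt measure_empty)
  moreover have "0 \<le> c" using assms(2)[of 0] by linarith
  ultimately show ?thesis using rearrangement_le_iff[OF assms(1,3)] assms(3) by simp
qed

text \<open>Below \<open>c\<close> every superlevel set of \<open>z\<close> contains an interval of
  length \<open>r > t\<close>.\<close>

lemma rearrangement_eq_bound:
  assumes z: "z \<in> borel_measurable leb01" and le: "\<And>s. \<bar>z s\<bar> \<le> c"
    and a: "0 \<le> a" "a + r \<le> 1" and eq: "\<And>s. s \<in> {a<..<a + r} \<Longrightarrow> \<bar>z s\<bar> = c"
    and t: "0 < t" "t < r"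
  shows "rearrangement z t = c"
proof (rule antisym[OF rearrangement_le_bound[OF z le t(1)]], rule ccontr)
  define \<theta> where "\<theta> = rearrangement z t"
  assume "\<not> c \<le> rearrangement z t"
  then have "{a<..<a + r} \<subseteq> {s \<in> space leb01. \<theta> < \<bar>z s\<bar>}"
    using a eq by (auto simp: \<theta>_def)
  then have "measure leb01 {a<..<a + r} \<le> distribution_fun z \<theta>"
    unfolding distribution_fun_alt by (rule leb01.finite_measure_mono[OF _ superlevel_sets[OF z]])
  moreover have "measure leb01 {a<..<a + r} = r"
    using emeasure_leb01_ivl[of a "a + r"] a t by (simp add: measure_def)
  ultimately have "r \<le> distribution_fun z \<theta>" by simp
  then show False
    using rearrangement_le_iff[OF z t(1), of \<theta>] rearrangement_nonneg[OF z t(1)] t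
    by (simp add: \<theta>_def)
qed

section \<open>Lagrange multipliers for a convex problem with one constraint\<close>

text \<open>\<open>convex\<close> says that the attainable pairs of values of \<open>q\<close> and
  \<open>p\<close> form a convex set, up to making \<open>p\<close> larger and \<open>q\<close>
  smaller. The multiplier is the slope of a line through the point (1, 1) with this set below it:
  slopes to points with \<open>q > 1\<close> never exceed slopes to points with
  \<open>q < 1\<close>, so the supremum of the former works. \<open>g0\<close> bounds these slopes,
  and \<open>g1\<close> provides one.\<close>

lemma lagrange_multiplier:
  fixes p q :: "'a \<Rightarrow> real"
  assumes convex: "\<And>g h a. g \<in> A \<Longrightarrow> h \<in> A \<Longrightarrow> 0 \<le> a \<Longrightarrow> a \<le> 1 \<Longrightarrow>
      \<exists>k\<in>A. a * p g + (1 - a) * p h \<le> p k \<and> q k \<le> a * q g + (1 - a) * q h"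
    and bound: "\<And>g. g \<in> A \<Longrightarrow> q g \<le> 1 \<Longrightarrow> p g \<le> 1"
    and g0: "g0 \<in> A" "q g0 < 1" and g1: "g1 \<in> A" "1 < q g1"
  obtains l where "\<And>g. g \<in> A \<Longrightarrow> p g - 1 \<le> l * (q g - 1)"
proof -
  have sep: "(p g - 1) / (q g - 1) \<le> (1 - p h) / (1 - q h)"
    if g: "g \<in> A" "1 < q g" and h: "h \<in> A" "q h < 1" for g h
  proof -
    \<comment> \<open>The weight for which the convex combination of \<open>q g\<close> and
      \<open>q h\<close> is exactly 1, so that \<open>bound\<close> applies.\<close>
    define a where "a = (1 - q h) / (q g - q h)"
    have a: "0 < a" "a < 1" using g h by (auto simp: a_def)
    have aq: "a * (q g - q h) = 1 - q h" using g h by (simp add: a_def)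
    obtain k where k: "k \<in> A" "a * p g + (1 - a) * p h \<le> p k" "q k \<le> a * q g + (1 - a) * q h"
      using convex[OF g(1) h(1), of a] a by auto
    have "a * q g + (1 - a) * q h = 1" using aq by (simp add: algebra_simps)
    then have "a * p g + (1 - a) * p h \<le> 1" using bound[OF k(1)] k by linarith
    then have "a * (p g - 1) \<le> (1 - a) * (1 - p h)" by (simp add: algebra_simps)
    then have "(q g - q h) * (a * (p g - 1)) \<le> (q g - q h) * ((1 - a) * (1 - p h))"
      using g h by (intro mult_left_mono) auto
    moreover have "(q g - q h) * (a * (p g - 1)) = (1 - q h) * (p g - 1)"
      using aq by (metis mult.assoc mult.commute)
    moreover have "(q g - q h) * ((1 - a) * (1 - p h)) = (q g - 1) * (1 - p h)"
    proof -
      have "(q g - q h) * (1 - a) = q g - 1" using aq by (simp add: algebra_simps)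
      then show ?thesis by (metis mult.assoc)
    qed
    ultimately show ?thesis using g h by (simp add: frac_le_eq divide_simps mult.commute)
  qed
  define R where "R = (\<lambda>g. (p g - 1) / (q g - 1)) ` {g \<in> A. 1 < q g}"
  have R_le: "r \<le> (1 - p h) / (1 - q h)" if "r \<in> R" "h \<in> A" "q h < 1" for r h
    using that sep unfolding R_def by blast
  have ne: "R \<noteq> {}" using g1 by (auto simp: R_def)
  have bdd: "bdd_above R" by (rule bdd_aboveI[OF R_le[OF _ g0]])
  show thesis
  proof (rule that)
    fix g assume g: "g \<in> A"
    consider "q g < 1" | "q g = 1" | "1 < q g" by linarith
    then show "p g - 1 \<le> Sup R * (q g - 1)"
    proof cases
      case 1
      have "Sup R \<le> (1 - p g) / (1 - q g)" by (rule cSup_least[OF ne R_le[OF _ g 1]])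
      then show ?thesis using 1 by (simp add: field_simps)
    next
      case 2
      then show ?thesis using bound[OF g] by simp
    next
      case 3
      have "(p g - 1) / (q g - 1) \<le> Sup R"
        by (rule cSup_upper[OF _ bdd]) (use g 3 in \<open>auto simp: R_def\<close>)
      then show ?thesis using 3 by (simp add: field_simps)
    qed
  qed
qed

section \<open>Comparison of the Orlicz norm with the modular\<close>

context
  fixes \<phi> \<omega> :: "real \<Rightarrow> real"
  assumes orlicz: "orlicz_function \<phi>" and weight: "weight_function \<omega>"
begin

text \<open>\<open>\<phi>\<close> is an increasing bijection of the half line, so it commutes with
  rearrangement. This makes the triangle inequality for \<open>lorentz\<close> available for
  modulars.\<close>

lemma modular_eq_lorentz:
  assumes x: "x \<in> borel_measurable leb01"
  shows "modular \<phi> \<omega> x = lorentz \<omega> (\<lambda>s. \<phi> (x s))"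
  unfolding modular_def lorentz_def using AE_leb01_pos
proof (intro nn_integral_cong_AE, eventually_elim)
  case (elim t)
  have "rearrangement (\<lambda>s. \<phi> (x s)) t = \<phi> (rearrangement x t)"
  proof (rule rearrangement_comp[OF x])
    show "strict_mono_on {0..} \<phi>" by (auto intro!: strict_mono_onI orlicz_less[OF orlicz])
    show "(\<lambda>s. \<phi> (x s)) \<in> borel_measurable leb01"
      using orlicz_measurable[OF orlicz] x by (rule measurable_compose[rotated])
  qed (use elim orlicz_image[OF orlicz] orlicz_abs[OF orlicz] orlicz_nonneg[OF orlicz] in auto)
  then show ?case by simp
qed

lemma orlicz_norm_scale:
  assumes x: "x \<in> borel_measurable leb01" and c: "0 < c"
  shows "orlicz_norm \<phi> \<omega> (\<lambda>s. c * x s) = ennreal c * orlicz_norm \<phi> \<omega> x"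
proof -
  note [measurable] = weight_measurable[OF weight] rearrangement_measurable[OF x]
  have "(\<integral>\<^sup>+t. ennreal (rearrangement (\<lambda>s. c * x s) t * rearrangement y t * \<omega> t) \<partial>leb01) =
      ennreal c * (\<integral>\<^sup>+t. ennreal (rearrangement x t * rearrangement y t * \<omega> t) \<partial>leb01)"
    if y: "y \<in> borel_measurable leb01" for y
  proof -
    note [measurable] = rearrangement_measurable[OF y]
    have "(\<integral>\<^sup>+t. ennreal (rearrangement (\<lambda>s. c * x s) t * rearrangement y t * \<omega> t) \<partial>leb01) =
      (\<integral>\<^sup>+t. ennreal c * ennreal (rearrangement x t * rearrangement y t * \<omega> t) \<partial>leb01)"
      using AE_leb01_pos by (intro nn_integral_cong_AE, eventually_elim)
        (use c in \<open>simp add: rearrangement_scale[OF x] ennreal_mult'[symmetric] mult.assoc\<close>)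
    then show ?thesis by (simp add: nn_integral_cmult)
  qed
  then show ?thesis
    unfolding orlicz_norm_def SUP_mult_left_ennreal by (intro SUP_cong) auto
qed

text \<open>The easy half of the description of the norm as an infimum, with \<open>l\<close> the
  reciprocal of \<open>k\<close>: Young's inequality for the rearrangements of \<open>x / l\<close>
  and \<open>y\<close>, integrated against \<open>\<omega>\<close>.\<close>

lemma orlicz_norm_le_modular:
  assumes x: "x \<in> borel_measurable leb01" and l: "0 < l"
  shows "orlicz_norm \<phi> \<omega> x \<le> ennreal l * (1 + modular \<phi> \<omega> (\<lambda>s. x s / l))"
  unfolding orlicz_norm_def
proof (rule SUP_least, clarify)
  fix y assume y: "y \<in> borel_measurable leb01" and mod: "modular (complementary \<phi>) \<omega> y \<le> 1"
  define z where "z s = x s / l" for s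
  have z: "z \<in> borel_measurable leb01" unfolding z_def using x by measurable
  note [measurable] = weight_measurable[OF weight] rearrangement_measurable[OF x]
    rearrangement_measurable[OF y] rearrangement_measurable[OF z]
    orlicz_measurable[OF orlicz] complementary_measurable[OF orlicz]
  have "(\<integral>\<^sup>+t. ennreal (rearrangement x t * rearrangement y t * \<omega> t) \<partial>leb01) \<le>
      (\<integral>\<^sup>+t. ennreal l * (ennreal (complementary \<phi> (rearrangement y t) * \<omega> t) +
        ennreal (\<phi> (rearrangement z t) * \<omega> t)) \<partial>leb01)"
    using AE_leb01_pos
  proof (intro nn_integral_mono_AE, eventually_elim)
    case (elim t)
    have xz: "rearrangement x t = l * rearrangement z t"
      using rearrangement_scale[OF z l, of t] l elim by (simp add: z_def)
    have \<omega>: "0 \<le> \<omega> t" using weight_nonneg[OF weight] elim by auto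
    have "rearrangement z t * rearrangement y t \<le>
        complementary \<phi> (rearrangement y t) + \<phi> (rearrangement z t)"
      using young[OF orlicz, of "rearrangement z t" "rearrangement y t"] by simp
    then have "l * (rearrangement z t * rearrangement y t * \<omega> t) \<le>
        l * (complementary \<phi> (rearrangement y t) * \<omega> t + \<phi> (rearrangement z t) * \<omega> t)"
      using l \<omega> unfolding distrib_right[symmetric] by (intro mult_left_mono mult_right_mono) auto
    then show ?case
      using l \<omega> orlicz_nonneg[OF orlicz] complementary_nonneg[OF orlicz] unfolding xz
      by (simp add: ennreal_plus[symmetric] ennreal_mult'[symmetric] ennreal_leI mult.assoc
          del: ennreal_plus)
  qed
  also have "\<dots> = ennreal l * (modular (complementary \<phi>) \<omega> y + modular \<phi> \<omega> z)"
    by (simp add: nn_integral_cmult nn_integral_add modular_def)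
  also have "\<dots> \<le> ennreal l * (1 + modular \<phi> \<omega> z)"
    by (intro mult_left_mono add_right_mono mod) simp
  finally show "(\<integral>\<^sup>+t. ennreal (rearrangement x t * rearrangement y t * \<omega> t) \<partial>leb01) \<le>
      ennreal l * (1 + modular \<phi> \<omega> (\<lambda>s. x s / l))"
    by (simp add: z_def[abs_def])
qed

lemma orlicz_norm_ge_antimono:
  assumes x: "x \<in> borel_measurable leb01"
    and g: "antimono_on {0<..<1} g" "\<And>t. t \<in> {0<..<1} \<Longrightarrow> 0 \<le> g t"
    and le: "(\<integral>\<^sup>+t. ennreal (complementary \<phi> (g t) * \<omega> t) \<partial>leb01) \<le> 1"
  shows "(\<integral>\<^sup>+t. ennreal (rearrangement x t * g t * \<omega> t) \<partial>leb01) \<le> orlicz_norm \<phi> \<omega> x"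
proof -
  have AE: "AE t in leb01. rearrangement g t = g t"
    by (rule rearrangement_of_antimono) (use g in auto)
  have "modular (complementary \<phi>) \<omega> g = (\<integral>\<^sup>+t. ennreal (complementary \<phi> (g t) * \<omega> t) \<partial>leb01)"
    unfolding modular_def using AE by (intro nn_integral_cong_AE, eventually_elim) simp
  then have "g \<in> {y \<in> borel_measurable leb01. modular (complementary \<phi>) \<omega> y \<le> 1}"
    using le antimono_measurable_leb01[OF g(1)] by simp
  then have "(\<integral>\<^sup>+t. ennreal (rearrangement x t * rearrangement g t * \<omega> t) \<partial>leb01) \<le> orlicz_norm \<phi> \<omega> x"
    unfolding orlicz_norm_def by (rule SUP_upper)
  also have "(\<integral>\<^sup>+t. ennreal (rearrangement x t * rearrangement g t * \<omega> t) \<partial>leb01) =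
      (\<integral>\<^sup>+t. ennreal (rearrangement x t * g t * \<omega> t) \<partial>leb01)"
    using AE by (intro nn_integral_cong_AE, eventually_elim) simp
  finally show ?thesis .
qed

text \<open>The maximisation of \<open>\<integral>x\<^sup>* g \<omega>\<close> over non-increasing \<open>g\<close> subject to \<open>\<integral>\<psi>(g) \<omega> \<le> 1\<close> has a Lagrange
  multiplier \<open>l\<close>; the unconstrained problem is then solved pointwise by equality in Young's
  inequality. Truncating at \<open>n\<close> keeps the pointwise solution admissible.\<close>
lemma orlicz_norm_one_imp_modular:
  assumes x: "x \<in> borel_measurable leb01" and norm: "orlicz_norm \<phi> \<omega> x = 1"
  obtains l where "0 < l" "ennreal l * (1 + modular \<phi> \<omega> (\<lambda>s. x s / l)) \<le> 1"
proof -
  let ?\<psi> = "complementary \<phi>"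
  define f where "f = rearrangement x"
  have f_nonneg: "0 \<le> f t" if "0 < t" for t
    unfolding f_def by (rule rearrangement_nonneg[OF x that])
  note [measurable] = weight_measurable[OF weight] rearrangement_measurable[OF x, folded f_def]
  have orlicz_comp: "(\<lambda>t. \<phi> (h t)) \<in> borel_measurable leb01"
    and compl_comp: "(\<lambda>t. ?\<psi> (h t)) \<in> borel_measurable leb01"
    if "h \<in> borel_measurable leb01" for h
    using measurable_compose[OF that orlicz_measurable[OF orlicz]]
      measurable_compose[OF that complementary_measurable[OF orlicz]] by simp_all
  note \<omega>_nonneg = weight_nonneg[OF weight]
  have \<omega>_int: "integrable leb01 \<omega>"
    by (rule integrableI_nonneg) (use weight_integral_finite[OF weight] \<omega>_nonneg in auto)
  have int_bounded: "integrable leb01 (\<lambda>t. h t * \<omega> t)"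
    if "h \<in> borel_measurable leb01" "\<And>t. 0 < t \<Longrightarrow> t < 1 \<Longrightarrow> 0 \<le> h t \<and> h t \<le> B" for h B
  proof (rule Bochner_Integration.integrable_bound)
    show "integrable leb01 (\<lambda>t. B * \<omega> t)" using \<omega>_int by simp
    show "(\<lambda>t. h t * \<omega> t) \<in> borel_measurable leb01" using that(1) by measurable
    show "AE t in leb01. norm (h t * \<omega> t) \<le> norm (B * \<omega> t)"
      using AE_leb01_pos
    proof eventually_elim
      case (elim t)
      then have "0 \<le> h t" "h t \<le> B" "0 \<le> \<omega> t" using that(2)[of t] \<omega>_nonneg[of t] by auto
      then show ?case by (simp add: abs_mult mult_right_mono)
    qed
  qed
  \<comment> \<open>Boundedness makes the integral in \<open>q\<close> finite, as
    \<open>\<omega>\<close> is integrable; a non-integrable function would have the default integral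
    0. For \<open>p\<close> integrability is shown separately in \<open>p_int\<close>.\<close>
  define A where "A = {g :: real \<Rightarrow> real. antimono_on {0<..<1} g \<and>
    (\<exists>B. \<forall>t\<in>{0<..<1}. 0 \<le> g t \<and> g t \<le> B)}"
  have A_meas: "g \<in> borel_measurable leb01" and A_nonneg: "0 < t \<Longrightarrow> t < 1 \<Longrightarrow> 0 \<le> g t"
    if "g \<in> A" for g t
    using that antimono_measurable_leb01 by (auto simp: A_def)
  define p where "p g = (\<integral>t. f t * g t * \<omega> t \<partial>leb01)" for g
  define q where "q g = (\<integral>t. ?\<psi> (g t) * \<omega> t \<partial>leb01)" for g
  have q_int: "integrable leb01 (\<lambda>t. ?\<psi> (g t) * \<omega> t)" if g: "g \<in> A" for g
  proof -
    obtain B where B: "\<forall>t\<in>{0<..<1}. 0 \<le> g t \<and> g t \<le> B" using g by (auto simp: A_def)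
    show ?thesis
    proof (rule int_bounded[OF compl_comp[OF A_meas[OF g]]])
      fix t :: real assume "0 < t" "t < 1"
      then have "0 \<le> g t" "g t \<le> B" using B by auto
      then show "0 \<le> ?\<psi> (g t) \<and> ?\<psi> (g t) \<le> ?\<psi> B"
        using complementary_nonneg[OF orlicz] complementary_le_abs[OF orlicz] by auto
    qed
  qed
  have feasible: "(\<integral>\<^sup>+t. ennreal (f t * g t * \<omega> t) \<partial>leb01) \<le> 1" if g: "g \<in> A" and qg: "q g \<le> 1" for g
  proof -
    have "(\<integral>\<^sup>+t. ennreal (?\<psi> (g t) * \<omega> t) \<partial>leb01) = ennreal (q g)"
      unfolding q_def
      by (rule nn_integral_eq_integral[OF q_int[OF g]])
        (use AE_leb01_pos in \<open>eventually_elim, simp add: complementary_nonneg[OF orlicz] \<omega>_nonneg\<close>)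
    then have "(\<integral>\<^sup>+t. ennreal (?\<psi> (g t) * \<omega> t) \<partial>leb01) \<le> 1"
      using qg by simp
    from orlicz_norm_ge_antimono[OF x _ _ this] g show ?thesis
      unfolding norm f_def A_def by auto
  qed
  have A_scale: "(\<lambda>t. c * g t) \<in> A" if g: "g \<in> A" and c: "0 \<le> c" for g c
  proof -
    obtain B where "antimono_on {0<..<1} g" and B: "\<forall>t\<in>{0<..<1}. 0 \<le> g t \<and> g t \<le> B"
      using g by (auto simp: A_def)
    then have "antimono_on {0<..<1} (\<lambda>t. c * g t)"
      using c by (auto simp: monotone_on_def intro: mult_left_mono)
    moreover have "\<forall>t\<in>{0<..<1}. 0 \<le> c * g t \<and> c * g t \<le> c * B"
      using B c by (auto intro: mult_left_mono)
    ultimately show ?thesis unfolding A_def by blast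
  qed
  have A_add: "(\<lambda>t. g t + h t) \<in> A" if g: "g \<in> A" and h: "h \<in> A" for g h
  proof -
    obtain B where g': "antimono_on {0<..<1} g" and B: "\<forall>t\<in>{0<..<1}. 0 \<le> g t \<and> g t \<le> B"
      using g by (auto simp: A_def)
    obtain C where h': "antimono_on {0<..<1} h" and C: "\<forall>t\<in>{0<..<1}. 0 \<le> h t \<and> h t \<le> C"
      using h by (auto simp: A_def)
    have "antimono_on {0<..<1} (\<lambda>t. g t + h t)"
      using g' h' by (auto simp: monotone_on_def intro: add_mono)
    moreover have "\<forall>t\<in>{0<..<1}. 0 \<le> g t + h t \<and> g t + h t \<le> B + C"
      using B C by (auto intro: add_mono)
    ultimately show ?thesis unfolding A_def by blast
  qed
  have p_nonneg: "AE t in leb01. 0 \<le> f t * g t * \<omega> t" if "g \<in> A" for g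
    using AE_leb01_pos by eventually_elim (simp add: f_nonneg A_nonneg[OF that] \<omega>_nonneg)
  have p_meas: "(\<lambda>t. f t * g t * \<omega> t) \<in> borel_measurable leb01" if "g \<in> A" for g
    using A_meas[OF that] by measurable
  have p_int: "integrable leb01 (\<lambda>t. f t * g t * \<omega> t)" if g: "g \<in> A" for g
  proof -
    \<comment> \<open>Dividing \<open>g\<close> by \<open>r\<close> makes it feasible, because by
      convexity the complement shrinks at least by the same factor. The finite norm then yields
      integrability.\<close>
    define r where "r = max 1 (q g)"
    have r: "1 \<le> r" "q g \<le> r" by (auto simp: r_def)
    have h: "(\<lambda>t. 1 / r * g t) \<in> A" by (rule A_scale[OF g]) (use r in simp)
    have "q (\<lambda>t. 1 / r * g t) \<le> (\<integral>t. 1 / r * (?\<psi> (g t) * \<omega> t) \<partial>leb01)"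
      unfolding q_def
    proof (rule integral_mono_AE[OF q_int[OF h] integrable_mult_right[OF q_int[OF g]]])
      show "AE t in leb01. ?\<psi> (1 / r * g t) * \<omega> t \<le> 1 / r * (?\<psi> (g t) * \<omega> t)"
        using AE_leb01_pos
      proof eventually_elim
        case (elim t)
        have "?\<psi> (1 / r * g t) \<le> 1 / r * ?\<psi> (g t)"
          by (rule complementary_scale_le[OF orlicz]) (use r in auto)
        then show ?case
          using \<omega>_nonneg[of t] elim by (metis less_imp_le mult.assoc mult_right_mono)
      qed
    qed
    also have "\<dots> = 1 / r * q g" by (simp add: q_def)
    also have "\<dots> \<le> 1" using r by simp
    finally have "(\<integral>\<^sup>+t. ennreal (f t * (1 / r * g t) * \<omega> t) \<partial>leb01) \<le> 1" by (rule feasible[OF h])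
    then have "integrable leb01 (\<lambda>t. f t * (1 / r * g t) * \<omega> t)"
      by (intro integrableI_nonneg p_meas[OF h] p_nonneg[OF h]) (auto intro: order.strict_trans1)
    then have "integrable leb01 (\<lambda>t. r * (f t * (1 / r * g t) * \<omega> t))" by (rule integrable_mult_right)
    moreover have "(\<lambda>t. r * (f t * (1 / r * g t) * \<omega> t)) = (\<lambda>t. f t * g t * \<omega> t)"
      using r by (auto simp: field_simps)
    ultimately show ?thesis by simp
  qed
  have one: "(\<lambda>_. 1) \<in> A" by (auto simp: A_def monotone_on_def)
  have zero: "(\<lambda>_. 0) \<in> A" by (auto simp: A_def monotone_on_def)
  \<comment> \<open>Otherwise \<open>f t * \<omega> t\<close> would vanish almost everywhere, and
    the norm would be 0.\<close>
  have "p (\<lambda>_. 1) \<noteq> 0"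
  proof
    assume "p (\<lambda>_. 1) = 0"
    then have "AE t in leb01. f t * 1 * \<omega> t = 0"
      unfolding p_def using integral_nonneg_eq_0_iff_AE[OF p_int[OF one] p_nonneg[OF one]] by simp
    then have "(\<integral>\<^sup>+t. ennreal (rearrangement x t * rearrangement y t * \<omega> t) \<partial>leb01) = (\<integral>\<^sup>+t. 0 \<partial>leb01)" for y
      by (intro nn_integral_cong_AE, eventually_elim) (auto simp: f_def)
    then have "orlicz_norm \<phi> \<omega> x \<le> 0" unfolding orlicz_norm_def by (intro SUP_least) simp
    then show False using norm by simp
  qed
  moreover have "0 \<le> p (\<lambda>_. 1)"
    unfolding p_def by (rule integral_nonneg_AE[OF p_nonneg[OF one]])
  ultimately have p1: "0 < p (\<lambda>_. 1)" by simp
  \<comment> \<open>The factor is chosen for \<open>p g1 = 2\<close>, above the bound 1 valid for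
    feasible functions. So \<open>g1\<close> violates the constraint, as the multiplier lemma asks,
    and it later forces the multiplier to be positive.\<close>
  define g1 where "g1 = (\<lambda>_::real. 2 / p (\<lambda>_. 1) * 1)"
  have g1: "g1 \<in> A" unfolding g1_def by (rule A_scale[OF one]) (use p1 in simp)
  have p_scale: "p (\<lambda>t. c * g t) = c * p g" for c g
  proof -
    have "(\<lambda>t. f t * (c * g t) * \<omega> t) = (\<lambda>t. c * (f t * g t * \<omega> t))" by (simp add: ac_simps)
    then show ?thesis by (simp add: p_def)
  qed
  have "p g1 = 2 / p (\<lambda>_. 1) * p (\<lambda>_. 1)" unfolding g1_def by (rule p_scale)
  also have "\<dots> = 2" using p1 by simp
  finally have pg1: "p g1 = 2" .
  have bound: "p g \<le> 1" if g: "g \<in> A" "q g \<le> 1" for g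
  proof -
    have "ennreal (p g) = (\<integral>\<^sup>+t. ennreal (f t * g t * \<omega> t) \<partial>leb01)"
      unfolding p_def by (rule nn_integral_eq_integral[symmetric, OF p_int[OF g(1)] p_nonneg[OF g(1)]])
    also have "\<dots> \<le> 1" by (rule feasible[OF g])
    finally show ?thesis by simp
  qed
  have qg1: "1 < q g1" using bound[OF g1] pg1 by linarith
  have q0: "q (\<lambda>_. 0) < 1" by (simp add: q_def complementary_zero[OF orlicz])
  have convex: "\<exists>k\<in>A. a * p g + (1 - a) * p h \<le> p k \<and> q k \<le> a * q g + (1 - a) * q h"
    if g: "g \<in> A" and h: "h \<in> A" and a: "0 \<le> a" "a \<le> 1" for g h a
  proof (rule bexI[of _ "\<lambda>t. a * g t + (1 - a) * h t"])
    show k: "(\<lambda>t. a * g t + (1 - a) * h t) \<in> A"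
      by (intro A_add A_scale g h) (use a in auto)
    have "p (\<lambda>t. a * g t + (1 - a) * h t) =
        (\<integral>t. a * (f t * g t * \<omega> t) + (1 - a) * (f t * h t * \<omega> t) \<partial>leb01)"
      unfolding p_def by (rule Bochner_Integration.integral_cong) (auto simp: algebra_simps)
    also have "\<dots> = a * p g + (1 - a) * p h"
      unfolding p_def using p_int[OF g] p_int[OF h] by simp
    finally have "a * p g + (1 - a) * p h \<le> p (\<lambda>t. a * g t + (1 - a) * h t)" by simp
    moreover have "q (\<lambda>t. a * g t + (1 - a) * h t) \<le>
        (\<integral>t. a * (?\<psi> (g t) * \<omega> t) + (1 - a) * (?\<psi> (h t) * \<omega> t) \<partial>leb01)"
      unfolding q_def
    proof (rule integral_mono_AE[OF q_int[OF k]])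
      show "integrable leb01 (\<lambda>t. a * (?\<psi> (g t) * \<omega> t) + (1 - a) * (?\<psi> (h t) * \<omega> t))"
        using q_int[OF g] q_int[OF h] by simp
      show "AE t in leb01. ?\<psi> (a * g t + (1 - a) * h t) * \<omega> t \<le>
          a * (?\<psi> (g t) * \<omega> t) + (1 - a) * (?\<psi> (h t) * \<omega> t)"
        using AE_leb01_pos
      proof eventually_elim
        case (elim t)
        have "?\<psi> (a * g t + (1 - a) * h t) \<le> a * ?\<psi> (g t) + (1 - a) * ?\<psi> (h t)"
          by (rule complementary_convex[OF orlicz]) (use a in auto)
        then have "?\<psi> (a * g t + (1 - a) * h t) * \<omega> t \<le> (a * ?\<psi> (g t) + (1 - a) * ?\<psi> (h t)) * \<omega> t"
          using \<omega>_nonneg[of t] elim by (intro mult_right_mono) auto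
        then show ?case by (simp add: algebra_simps)
      qed
    qed
    moreover have "\<dots> = a * q g + (1 - a) * q h"
      unfolding q_def using q_int[OF g] q_int[OF h] by simp
    ultimately show "a * p g + (1 - a) * p h \<le> p (\<lambda>t. a * g t + (1 - a) * h t) \<and>
        q (\<lambda>t. a * g t + (1 - a) * h t) \<le> a * q g + (1 - a) * q h" by linarith
  qed
  obtain l where l: "\<And>g. g \<in> A \<Longrightarrow> p g - 1 \<le> l * (q g - 1)"
    using lagrange_multiplier[of A p q, OF convex bound zero q0 g1 qg1] by blast
  have l_pos: "0 < l"
  proof -
    have "1 \<le> l * (q g1 - 1)" using l[OF g1] pg1 by simp
    then have "0 < l * (q g1 - 1)" by linarith
    then show ?thesis using qg1 by (simp add: zero_less_mult_iff)
  qed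
  obtain s where s: "mono_on {0..} s" "\<And>u. 0 \<le> u \<Longrightarrow> 0 \<le> s u"
      "\<And>u. 0 \<le> u \<Longrightarrow> ?\<psi> (s u) \<le> u * s u - \<phi> u"
    using young_equality[OF orlicz] by blast
  \<comment> \<open>The rearrangement of \<open>x / l\<close>, with \<open>f\<close> cut off at
    \<open>n\<close> so that \<open>s\<close> composed with \<open>h n\<close> is bounded and
    belongs to \<open>A\<close>.\<close>
  define h where "h n t = min (f t) (real n) / l" for n :: nat and t
  have h_nonneg: "0 \<le> h n t" if "0 < t" for n t
    using f_nonneg[OF that] l_pos by (simp add: h_def)
  have h_le: "h n t \<le> real n / l" for n t
    using l_pos by (simp add: h_def divide_right_mono)
  have h_meas: "h n \<in> borel_measurable leb01" for n
    unfolding h_def by measurable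
  have h_anti: "h n t \<le> h n t'" if "0 < t'" "t' \<le> t" for n t t'
    using rearrangement_decreasing[OF x that] l_pos
    by (auto simp: h_def f_def intro!: divide_right_mono)
  have s_mono: "s u \<le> s v" if "0 \<le> u" "u \<le> v" for u v
    using s(1) that by (auto simp: monotone_on_def)
  have g: "(\<lambda>t. s (h n t)) \<in> A" for n
  proof -
    have "antimono_on {0<..<1} (\<lambda>t. s (h n t))"
      by (auto simp: monotone_on_def intro!: s_mono h_nonneg h_anti)
    moreover have "\<forall>t\<in>{0<..<1}. 0 \<le> s (h n t) \<and> s (h n t) \<le> s (real n / l)"
      by (auto intro!: s(2) s_mono h_nonneg h_le)
    ultimately show ?thesis unfolding A_def by blast
  qed
  have h_int: "integrable leb01 (\<lambda>t. \<phi> (h n t) * \<omega> t)" for n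
    by (rule int_bounded[OF orlicz_comp[OF h_meas], of _ "\<phi> (real n / l)"])
      (auto intro!: orlicz_nonneg[OF orlicz] orlicz_le[OF orlicz] h_nonneg h_le)
  \<comment> \<open>Young's equality at \<open>?g\<close> bounds
    \<open>l * (\<phi> (h n t) + ?\<psi> (?g t))\<close> by
    \<open>min (f t) (real n) * ?g t\<close>, hence by \<open>f t * ?g t\<close>. After integration
    the multiplier inequality bounds \<open>p ?g - l * q ?g\<close> by \<open>1 - l\<close>.\<close>
  have le: "l * (\<integral>t. \<phi> (h n t) * \<omega> t \<partial>leb01) \<le> 1 - l" for n
  proof -
    let ?g = "\<lambda>t. s (h n t)"
    have "l * (\<integral>t. \<phi> (h n t) * \<omega> t \<partial>leb01) = (\<integral>t. l * (\<phi> (h n t) * \<omega> t) \<partial>leb01)" by simp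
    also have "\<dots> \<le> (\<integral>t. f t * ?g t * \<omega> t - l * (?\<psi> (?g t) * \<omega> t) \<partial>leb01)"
    proof (rule integral_mono_AE)
      show "integrable leb01 (\<lambda>t. f t * ?g t * \<omega> t - l * (?\<psi> (?g t) * \<omega> t))"
        using p_int[OF g] q_int[OF g] by simp
      show "AE t in leb01. l * (\<phi> (h n t) * \<omega> t) \<le> f t * ?g t * \<omega> t - l * (?\<psi> (?g t) * \<omega> t)"
        using AE_leb01_pos
      proof eventually_elim
        case (elim t)
        then have h0: "0 \<le> h n t" using h_nonneg by simp
        have "l * \<phi> (h n t) + l * ?\<psi> (?g t) \<le> l * (h n t * ?g t)"
          using mult_left_mono[OF s(3)[OF h0], of l] l_pos by (simp add: algebra_simps)
        also have "\<dots> = min (f t) (real n) * ?g t" using l_pos by (simp add: h_def)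
        also have "\<dots> \<le> f t * ?g t" using s(2)[OF h0] by (intro mult_right_mono) auto
        finally have "(l * \<phi> (h n t) + l * ?\<psi> (?g t)) * \<omega> t \<le> f t * ?g t * \<omega> t"
          using \<omega>_nonneg[of t] elim by (intro mult_right_mono) auto
        then show ?case by (simp add: algebra_simps)
      qed
    qed (use h_int in simp)
    also have "\<dots> = p ?g - l * q ?g"
      unfolding p_def q_def using p_int[OF g] q_int[OF g] by simp
    also have "\<dots> \<le> 1 - l" using l[OF g, of n] by (simp add: algebra_simps)
    finally show ?thesis .
  qed
  have I_nonneg: "AE t in leb01. 0 \<le> \<phi> (h n t) * \<omega> t" for n
    using AE_leb01_pos by eventually_elim (simp add: orlicz_nonneg[OF orlicz] \<omega>_nonneg)
  \<comment> \<open>The bound \<open>(1 - l) / l\<close> has to be nonnegative to survive the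
    passage to \<open>ennreal\<close>. The truncation at 0 already shows this.\<close>
  have l1: "l \<le> 1"
  proof -
    have "0 \<le> l * (\<integral>t. \<phi> (h 0 t) * \<omega> t \<partial>leb01)"
      using l_pos integral_nonneg_AE[OF I_nonneg] by simp
    then show ?thesis using le[of 0] by linarith
  qed
  \<comment> \<open>For each \<open>t\<close> the cut-off is inactive once \<open>n\<close> is
    large, so monotone convergence carries the bound over to the full modular.\<close>
  have "modular \<phi> \<omega> (\<lambda>s. x s / l) \<le> (\<integral>\<^sup>+t. (SUP n. ennreal (\<phi> (h n t) * \<omega> t)) \<partial>leb01)"
    unfolding modular_def using AE_leb01_pos
  proof (intro nn_integral_mono_AE, eventually_elim)
    case (elim t)
    obtain n where "f t \<le> real n" using real_arch_simple by blast
    then have "rearrangement (\<lambda>s. x s / l) t = h n t"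
      using rearrangement_scale[OF x, of "1 / l" t] l_pos elim by (simp add: h_def f_def min_def)
    then show ?case by (auto intro: SUP_upper2[of n])
  qed
  also have "\<dots> = (SUP n. \<integral>\<^sup>+t. ennreal (\<phi> (h n t) * \<omega> t) \<partial>leb01)"
  proof (rule nn_integral_monotone_convergence_SUP_AE)
    show "AE t in leb01. ennreal (\<phi> (h n t) * \<omega> t) \<le> ennreal (\<phi> (h (Suc n) t) * \<omega> t)" for n
      using AE_leb01_pos
    proof eventually_elim
      case (elim t)
      have "h n t \<le> h (Suc n) t" using l_pos by (auto simp: h_def intro!: divide_right_mono)
      then show ?case
        using elim h_nonneg \<omega>_nonneg[of t]
        by (intro ennreal_leI mult_right_mono orlicz_le[OF orlicz]) auto
    qed
    show "(\<lambda>t. ennreal (\<phi> (h n t) * \<omega> t)) \<in> borel_measurable leb01" for n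
      using orlicz_comp[OF h_meas[of n]] by measurable
  qed
  also have "\<dots> \<le> ennreal ((1 - l) / l)"
  proof (rule SUP_least)
    fix n
    have "(\<integral>\<^sup>+t. ennreal (\<phi> (h n t) * \<omega> t) \<partial>leb01) = ennreal (\<integral>t. \<phi> (h n t) * \<omega> t \<partial>leb01)"
      by (rule nn_integral_eq_integral[OF h_int I_nonneg])
    also have "\<dots> \<le> ennreal ((1 - l) / l)"
      using le[of n] l_pos by (intro ennreal_leI) (simp add: field_simps)
    finally show "(\<integral>\<^sup>+t. ennreal (\<phi> (h n t) * \<omega> t) \<partial>leb01) \<le> ennreal ((1 - l) / l)" .
  qed
  finally have "ennreal l * (1 + modular \<phi> \<omega> (\<lambda>s. x s / l)) \<le> ennreal l * (1 + ennreal ((1 - l) / l))"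
    by (intro mult_left_mono add_left_mono) auto
  also have "\<dots> = ennreal (l * (1 + (1 - l) / l))"
    using l_pos l1 by (simp add: ennreal_mult' ennreal_plus flip: ennreal_1)
  also have "l * (1 + (1 - l) / l) = 1" using l_pos by (simp add: field_simps)
  finally show thesis using that[OF l_pos] by simp
qed

section \<open>Non-squareness for \<alpha> > 1/2\<close>

lemma non_square_pair:
  assumes half: "1/2 < \<alpha>" and pos: "\<forall>t. 0 < t \<longrightarrow> t < \<alpha> \<longrightarrow> 0 < \<omega> t"
    and x: "x \<in> borel_measurable leb01" "orlicz_norm \<phi> \<omega> x = 1"
    and y: "y \<in> borel_measurable leb01" "orlicz_norm \<phi> \<omega> y = 1"
  shows "min (orlicz_norm \<phi> \<omega> (\<lambda>s. (x s - y s) / 2)) (orlicz_norm \<phi> \<omega> (\<lambda>s. (x s + y s) / 2)) < 1"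
proof (rule ccontr)
  assume "\<not> ?thesis"
  then have ge1: "1 \<le> orlicz_norm \<phi> \<omega> (\<lambda>s. (x s - y s) / 2)" "1 \<le> orlicz_norm \<phi> \<omega> (\<lambda>s. (x s + y s) / 2)"
    by (auto simp: min_def not_less split: if_splits)
  note [measurable] = x(1) y(1)
  obtain k where k: "0 < k" "ennreal k * (1 + modular \<phi> \<omega> (\<lambda>s. x s / k)) \<le> 1"
    using orlicz_norm_one_imp_modular[OF x] by blast
  obtain m where m: "0 < m" "ennreal m * (1 + modular \<phi> \<omega> (\<lambda>s. y s / m)) \<le> 1"
    using orlicz_norm_one_imp_modular[OF y] by blast
  have modular_le: "r \<le> 1 \<and> \<rho> \<le> ennreal (1 / r - 1)"
    if r: "0 < r" "ennreal r * (1 + \<rho>) \<le> 1" for r :: real and \<rho> :: ennreal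
  proof (cases \<rho>)
    case (real \<sigma>)
    then have "ennreal r * (1 + \<rho>) = ennreal (r * (1 + \<sigma>))"
      using r by (simp add: ennreal_mult' ennreal_plus flip: ennreal_1)
    with r(2) have "r * (1 + \<sigma>) \<le> 1" by simp
    moreover have "r * 1 \<le> r * (1 + \<sigma>)" using r real by (intro mult_left_mono) auto
    moreover from calculation have "\<sigma> \<le> 1 / r - 1" using r by (simp add: field_simps)
    ultimately show ?thesis using real by (auto intro: ennreal_leI)
  next
    case top
    then show ?thesis using r by (simp add: ennreal_mult_top top_unique)
  qed
  note k' = modular_le[OF k] and m' = modular_le[OF m]
  \<comment> \<open>This choice makes \<open>(x s + y s) / l\<close> the convex combination of
    \<open>x s / k\<close> and \<open>y s / m\<close> with weights \<open>a\<close> and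
    \<open>b\<close>, and \<open>(x s - y s) / l\<close> the same with \<open>y\<close>
    negated.\<close>
  define l where "l = k + m"
  have l: "0 < l" "l \<le> 2" using k m k' m' by (auto simp: l_def)
  define a b where "a = k / l" and "b = m / l"
  have ab: "0 < a" "0 < b" "a + b = 1"
    using k m l by (auto simp: a_def b_def l_def add_divide_distrib[symmetric])
  have comb: "(x s + y s) / l = a * (x s / k) + b * (y s / m)"
    "(x s - y s) / l = a * (x s / k) - b * (y s / m)" for s
    using k m l by (auto simp: a_def b_def field_simps)
  define F F' G where "F s = \<phi> ((x s + y s) / l)" and "F' s = \<phi> ((x s - y s) / l)"
    and "G s = a * \<phi> (x s / k) + b * \<phi> (y s / m)" for s
  have \<phi>_comp: "(\<lambda>s. \<phi> (z s)) \<in> borel_measurable leb01" if "z \<in> borel_measurable leb01" for z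
    using measurable_compose[OF that orlicz_measurable[OF orlicz]] .
  have meas: "F \<in> borel_measurable leb01" "F' \<in> borel_measurable leb01"
    "(\<lambda>s. \<phi> (x s / k)) \<in> borel_measurable leb01" "(\<lambda>s. \<phi> (y s / m)) \<in> borel_measurable leb01"
    unfolding F_def F'_def by (auto intro!: \<phi>_comp)
  then have G: "G \<in> borel_measurable leb01" unfolding G_def by measurable
  have \<phi>0: "0 \<le> \<phi> u" for u by (rule orlicz_nonneg[OF orlicz])
  have nonneg: "0 \<le> F s" "0 \<le> F' s" "0 \<le> G s" for s
    using ab by (auto simp: F_def F'_def G_def \<phi>0)
  have FG: "F s \<le> G s" and F'G: "F' s \<le> G s" for s
    using orlicz_convexD[OF orlicz, of a b "x s / k" "y s / m"]
      orlicz_convexD[OF orlicz, of a b "x s / k" "- (y s / m)"] ab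
    by (auto simp: F_def F'_def G_def comb orlicz_minus[OF orlicz])
  \<comment> \<open>Here \<open>z\<close> has norm at least 2, which
    \<open>orlicz_norm_le_modular\<close> at parameter \<open>l\<close> turns into a lower bound for
    the modular. The bound \<open>2 / l - 1\<close> is exactly the upper bound found for
    \<open>lorentz \<omega> G\<close> below.\<close>
  have ge: "ennreal (2 / l - 1) \<le> modular \<phi> \<omega> (\<lambda>s. z s / l)"
    if z: "z \<in> borel_measurable leb01" and half: "1 \<le> orlicz_norm \<phi> \<omega> (\<lambda>s. z s / 2)" for z
  proof -
    have "ennreal 2 * 1 \<le> ennreal 2 * orlicz_norm \<phi> \<omega> (\<lambda>s. z s / 2)"
      by (intro mult_left_mono half) simp
    also have "\<dots> = orlicz_norm \<phi> \<omega> (\<lambda>s. 2 * (z s / 2))"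
      by (rule orlicz_norm_scale[symmetric]) (use z in auto)
    also have "\<dots> \<le> ennreal l * (1 + modular \<phi> \<omega> (\<lambda>s. z s / l))"
      using orlicz_norm_le_modular[OF z l(1)] by simp
    finally have *: "ennreal 2 \<le> ennreal l * (1 + modular \<phi> \<omega> (\<lambda>s. z s / l))" by simp
    show ?thesis
    proof (cases "modular \<phi> \<omega> (\<lambda>s. z s / l)")
      case (real r)
      then have "ennreal l * (1 + modular \<phi> \<omega> (\<lambda>s. z s / l)) = ennreal (l * (1 + r))"
        using l by (simp add: ennreal_mult' ennreal_plus flip: ennreal_1)
      with * have "ennreal 2 \<le> ennreal (l * (1 + r))" by simp
      then have "2 \<le> l * (1 + r)" using l real by (subst (asm) ennreal_le_iff) auto
      then have "2 / l - 1 \<le> r" using l by (simp add: field_simps)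
      then show ?thesis using real by (auto intro: ennreal_leI)
    qed simp
  qed
  have geF: "ennreal (2 / l - 1) \<le> lorentz \<omega> F" "ennreal (2 / l - 1) \<le> lorentz \<omega> F'"
    using ge[of "\<lambda>s. x s + y s"] ge[of "\<lambda>s. x s - y s"] ge1
    by (simp_all add: F_def[abs_def] F'_def[abs_def] modular_eq_lorentz)
  have "lorentz \<omega> G \<le> lorentz \<omega> (\<lambda>s. a * \<phi> (x s / k)) + lorentz \<omega> (\<lambda>s. b * \<phi> (y s / m))"
    by (rule lorentz_subadditive[OF weight _ _ G])
      (use meas ab \<phi>0 in \<open>auto simp: G_def abs_mult intro: order_trans[OF abs_triangle_ineq]\<close>)
  also have "\<dots> = ennreal a * modular \<phi> \<omega> (\<lambda>s. x s / k) + ennreal b * modular \<phi> \<omega> (\<lambda>s. y s / m)"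
    by (simp add: lorentz_scale[OF weight] meas ab modular_eq_lorentz)
  also have "\<dots> \<le> ennreal a * ennreal (1 / k - 1) + ennreal b * ennreal (1 / m - 1)"
    using k' m' by (intro add_mono mult_left_mono) auto
  also have "\<dots> = ennreal (a * (1 / k - 1) + b * (1 / m - 1))"
    using ab k m k' m' by (simp add: ennreal_mult' ennreal_plus)
  also have "a * (1 / k - 1) + b * (1 / m - 1) = 2 / l - 1"
  proof -
    have "a * (1 / k - 1) = 1 / l - a" "b * (1 / m - 1) = 1 / l - b"
      using k m by (simp_all add: a_def b_def right_diff_distrib)
    then show ?thesis using ab by simp
  qed
  finally have leG: "lorentz \<omega> G \<le> ennreal (2 / l - 1)" .
  have "AE s in leb01. G s = 0"
  proof (rule AE_zero_of_lorentz_eq[OF weight half pos meas(1,2) G])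
    show "\<bar>F s\<bar> \<le> \<bar>G s\<bar>" "\<bar>F' s\<bar> \<le> \<bar>G s\<bar>" for s using FG F'G nonneg by simp_all
    show "lorentz \<omega> G \<le> lorentz \<omega> F" "lorentz \<omega> G \<le> lorentz \<omega> F'"
      using leG geF by (auto intro: order_trans)
    show "lorentz \<omega> G < \<infinity>" using leG by (rule order.strict_trans1) simp
    show "\<bar>F s\<bar> < \<bar>G s\<bar> \<or> \<bar>F' s\<bar> < \<bar>G s\<bar>" if "G s \<noteq> 0" for s
    proof -
      have "x s / k \<noteq> 0 \<or> y s / m \<noteq> 0"
        using that by (auto simp: G_def orlicz_zero[OF orlicz])
      from orlicz_convex_combination_less[OF orlicz ab this] show ?thesis
        using nonneg[of s] by (simp add: F_def F'_def G_def comb)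
    qed
  qed
  \<comment> \<open>Once \<open>x\<close> vanishes almost everywhere, it represents the same class
    as \<open>2 * x\<close>, so its norm 1 would equal 2.\<close>
  then have "AE s in leb01. x s = 0"
  proof eventually_elim
    case (elim s)
    have "a * \<phi> (x s / k) = 0"
      using elim ab \<phi>0[of "x s / k"] \<phi>0[of "y s / m"] unfolding G_def
      by (smt (verit) mult_nonneg_nonneg)
    then show ?case using ab k orlicz_pos[OF orlicz, of "x s / k"] by auto
  qed
  then have "orlicz_norm \<phi> \<omega> x = orlicz_norm \<phi> \<omega> (\<lambda>s. 2 * x s)"
    by (intro orlicz_norm_cong_AE) (auto elim: eventually_mono)
  also have "\<dots> = 2" using orlicz_norm_scale[OF x(1), of 2] x(2) by simp
  finally show False using x(2) by simp
qed

section \<open>Failure of non-squareness for \<alpha> \<le> 1/2\<close>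

lemma bounded_in_orlicz_lorentz_space:
  assumes x: "x \<in> borel_measurable leb01" and bound: "\<And>s. \<bar>x s\<bar> \<le> c"
  shows "modular \<phi> \<omega> x < \<infinity>" "x \<in> orlicz_lorentz_space \<phi> \<omega>"
proof -
  note [measurable] = weight_measurable[OF weight]
  have "modular \<phi> \<omega> x \<le> (\<integral>\<^sup>+t. ennreal (\<phi> c) * ennreal (\<omega> t) \<partial>leb01)"
    unfolding modular_def using AE_leb01_pos
  proof (intro nn_integral_mono_AE, eventually_elim)
    case (elim t)
    have "\<phi> (rearrangement x t) \<le> \<phi> c"
      using elim by (intro orlicz_le[OF orlicz] rearrangement_nonneg[OF x]
          rearrangement_le_bound[OF x bound]) auto
    then have "\<phi> (rearrangement x t) * \<omega> t \<le> \<phi> c * \<omega> t"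
      using weight_nonneg[OF weight, of t] elim by (intro mult_right_mono) auto
    then show ?case
      by (simp add: ennreal_mult'[symmetric] orlicz_nonneg[OF orlicz] ennreal_leI)
  qed
  also have "\<dots> = ennreal (\<phi> c) * (\<integral>\<^sup>+t. ennreal (\<omega> t) \<partial>leb01)"
    by (rule nn_integral_cmult) simp
  also have "\<dots> < \<infinity>"
    using weight_integral_finite[OF weight] by (simp add: ennreal_mult_less_top)
  finally show fin: "modular \<phi> \<omega> x < \<infinity>" .
  then show "x \<in> orlicz_lorentz_space \<phi> \<omega>"
    using x by (auto simp: orlicz_lorentz_space_def intro!: exI[of _ 1])
qed

lemma orlicz_norm_one_finite: "orlicz_norm \<phi> \<omega> (\<lambda>_. 1) < \<infinity>"
proof -
  have "orlicz_norm \<phi> \<omega> (\<lambda>_. 1) \<le> ennreal 1 * (1 + modular \<phi> \<omega> (\<lambda>s. 1 / 1))"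
    by (rule orlicz_norm_le_modular) auto
  also have "\<dots> < \<infinity>"
    using bounded_in_orlicz_lorentz_space(1)[of "\<lambda>_. 1" 1] by simp
  finally show ?thesis .
qed

text \<open>A small constant competitor turns norm 0 into \<open>\<omega> t = 0\<close> almost
  everywhere, whereas monotonicity keeps \<open>\<omega>\<close> above the positive value
  \<open>\<omega> t\<^sub>0\<close> on the whole interval \<open>{0<..<t\<^sub>0}\<close>.\<close>

lemma orlicz_norm_one_pos:
  assumes t0: "0 < t\<^sub>0" "t\<^sub>0 < 1" "\<omega> t\<^sub>0 \<noteq> 0"
  shows "0 < orlicz_norm \<phi> \<omega> (\<lambda>_. 1)"
proof (rule ccontr)
  assume "\<not> ?thesis"
  then have N0: "orlicz_norm \<phi> \<omega> (\<lambda>_. 1) = 0" by simp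
  note [measurable] = weight_measurable[OF weight]
  let ?\<psi> = "complementary \<phi>"
  obtain W where W: "0 \<le> W" "(\<integral>\<^sup>+t. ennreal (\<omega> t) \<partial>leb01) = ennreal W"
    using weight_integral_finite[OF weight] by (cases "\<integral>\<^sup>+t. ennreal (\<omega> t) \<partial>leb01") auto
  have \<psi>0: "0 \<le> ?\<psi> v" for v by (rule complementary_nonneg[OF orlicz])
  \<comment> \<open>Chosen for \<open>c * ?\<psi> 1 * W \<le> 1\<close>; convexity gives
    \<open>?\<psi> c \<le> c * ?\<psi> 1\<close>, so the constant \<open>c\<close> is an admissible
    competitor.\<close>
  define c where "c = 1 / (1 + ?\<psi> 1 * W)"
  have den: "1 \<le> 1 + ?\<psi> 1 * W" using W \<psi>0 by simp
  then have c: "0 < c" "c \<le> 1" by (auto simp: c_def)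
  have "?\<psi> c * W \<le> c * ?\<psi> 1 * W"
    using complementary_scale_le[OF orlicz, of c 1] c W by (intro mult_right_mono) auto
  also have "\<dots> \<le> 1" using den by (simp add: c_def field_simps)
  finally have "?\<psi> c * W \<le> 1" .
  moreover have "(\<integral>\<^sup>+t. ennreal (?\<psi> c * \<omega> t) \<partial>leb01) = ennreal (?\<psi> c * W)"
    by (simp add: ennreal_mult' \<psi>0 nn_integral_cmult W)
  ultimately have "(\<integral>\<^sup>+t. ennreal (?\<psi> c * \<omega> t) \<partial>leb01) \<le> 1" by simp
  then have le0: "(\<integral>\<^sup>+t. ennreal (rearrangement (\<lambda>_. 1) t * c * \<omega> t) \<partial>leb01) \<le> 0"
    using orlicz_norm_ge_antimono[of "\<lambda>_. 1" "\<lambda>_. c"] c N0 by (simp add: monotone_on_def)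
  have one: "rearrangement (\<lambda>_. 1) t = 1" if "0 < t" "t < 1" for t
    by (rule rearrangement_eq_bound[where a = 0 and r = 1]) (use that in auto)
  have "(\<integral>\<^sup>+t. ennreal (rearrangement (\<lambda>_. 1) t * c * \<omega> t) \<partial>leb01) = (\<integral>\<^sup>+t. ennreal (c * \<omega> t) \<partial>leb01)"
    using AE_leb01_pos by (intro nn_integral_cong_AE, eventually_elim) (simp add: one)
  then have "(\<integral>\<^sup>+t. ennreal (c * \<omega> t) \<partial>leb01) = 0" using le0 by simp
  then have AE: "AE t in leb01. ennreal (c * \<omega> t) = 0"
    by (subst (asm) nn_integral_0_iff_AE) auto
  have "AE t in leb01. t \<notin> {0<..<t\<^sub>0}"
    using AE AE_leb01_pos
  proof eventually_elim
    case (elim t)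
    show ?case
    proof
      assume t: "t \<in> {0<..<t\<^sub>0}"
      have "0 < \<omega> t\<^sub>0" using weight_nonneg[OF weight, of t\<^sub>0] t0 by auto
      also have "\<dots> \<le> \<omega> t" using weight_decreasing[OF weight, of t t\<^sub>0] t t0 by auto
      finally have "0 < c * \<omega> t" using c by simp
      then show False using elim by (simp add: ennreal_eq_0_iff)
    qed
  qed
  moreover have "{0<..<t\<^sub>0} \<in> sets leb01"
  proof -
    have "{0<..<t\<^sub>0} \<subseteq> {0..<1}" using t0 by auto
    then show ?thesis by (auto simp: sets_restrict_space_iff)
  qed
  ultimately have "emeasure leb01 {0<..<t\<^sub>0} = 0"
    using AE_iff_null_sets[of "{0<..<t\<^sub>0}" leb01] by auto
  then show False using emeasure_leb01_ivl[of 0 t\<^sub>0] t0 by simp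
qed

lemma not_non_square:
  assumes t0: "0 < t\<^sub>0" "t\<^sub>0 < 1" "\<omega> t\<^sub>0 \<noteq> 0"
    and zero: "\<And>t. 1/2 < t \<Longrightarrow> t < 1 \<Longrightarrow> \<omega> t = 0"
  shows "\<not> non_square (orlicz_lorentz_space \<phi> \<omega>) (orlicz_norm \<phi> \<omega>)"
proof
  assume ns: "non_square (orlicz_lorentz_space \<phi> \<omega>) (orlicz_norm \<phi> \<omega>)"
  obtain \<kappa> where \<kappa>: "orlicz_norm \<phi> \<omega> (\<lambda>_. 1) = ennreal \<kappa>" "0 < \<kappa>"
    using orlicz_norm_one_finite orlicz_norm_one_pos[OF t0]
    by (cases "orlicz_norm \<phi> \<omega> (\<lambda>_. 1)") auto
  define c where "c = 1 / \<kappa>"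
  have c: "0 < c" using \<kappa> by (simp add: c_def)
  have "orlicz_norm \<phi> \<omega> (\<lambda>_. c * 1) = ennreal c * ennreal \<kappa>"
    using orlicz_norm_scale[OF _ c, of "\<lambda>_. 1"] \<kappa> by simp
  also have "\<dots> = 1" using \<kappa> c by (simp add: c_def ennreal_mult'[symmetric])
  finally have const: "orlicz_norm \<phi> \<omega> (\<lambda>_. c) = 1" by simp
  have [measurable]: "(\<lambda>s. s) \<in> borel_measurable leb01"
    by (intro measurable_restrict_space1 measurable_completion) simp
  \<comment> \<open>The weight is known to vanish only strictly beyond 1/2, so the point 1/2 itself
    is discarded as a null set.\<close>
  have "AE t in lebesgue. t \<noteq> (1/2 :: real)"
    by (rule AE_completion) (rule AE_lborel_singleton)
  then have AE_half: "AE t in leb01. t \<noteq> 1/2"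
    by (subst AE_restrict_space_iff) (auto elim: eventually_mono)
  \<comment> \<open>The norm sees the rearrangement only on \<open>(0, 1/2)\<close>. A function
    bounded by \<open>c\<close> and equal to \<open>c\<close> in absolute value on an interval of
    length 1/2 has rearrangement \<open>c\<close> there, as the constant does.\<close>
  have norm: "orlicz_norm \<phi> \<omega> z = 1"
    if z: "z \<in> borel_measurable leb01" and le: "\<And>s. \<bar>z s\<bar> \<le> c"
      and a: "0 \<le> a" "a + 1/2 \<le> 1" and eq: "\<And>s. s \<in> {a<..<a + 1/2} \<Longrightarrow> \<bar>z s\<bar> = c" for z a
  proof -
    have "AE t in leb01. rearrangement z t * \<omega> t = rearrangement (\<lambda>_. c) t * \<omega> t"
      using AE_half AE_leb01_pos
    proof eventually_elim
      case (elim t)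
      show ?case
      proof (cases "t < 1/2")
        case True
        then have "rearrangement z t = c" "rearrangement (\<lambda>_. c) t = c"
          using rearrangement_eq_bound[OF z le a eq, of t]
            rearrangement_eq_bound[of "\<lambda>_. c" c 0 "1/2" t] elim c by auto
        then show ?thesis by simp
      qed (use zero elim in auto)
    qed
    then have "(\<integral>\<^sup>+t. ennreal (rearrangement z t * rearrangement y t * \<omega> t) \<partial>leb01) =
        (\<integral>\<^sup>+t. ennreal (rearrangement (\<lambda>_. c) t * rearrangement y t * \<omega> t) \<partial>leb01)" for y
      by (intro nn_integral_cong_AE, eventually_elim) (metis mult.assoc mult.commute)
    then show ?thesis using const unfolding orlicz_norm_def by presburger
  qed
  \<comment> \<open>The half sum with the constant is \<open>c\<close> to the left of 1/2 and 0 from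
    there on; the half difference is 0 to the left and \<open>c\<close> from there on. So
    \<open>norm\<close> applies to both.\<close>
  define y where "y s = (if s < 1/2 then c else - c)" for s :: real
  have y: "y \<in> borel_measurable leb01" unfolding y_def by measurable
  have "y \<in> orlicz_lorentz_space \<phi> \<omega>"
    by (rule bounded_in_orlicz_lorentz_space(2)[OF y, of c]) (use c in \<open>auto simp: y_def\<close>)
  moreover have "(\<lambda>_. c) \<in> orlicz_lorentz_space \<phi> \<omega>"
    by (rule bounded_in_orlicz_lorentz_space(2)[of _ c]) (use c in auto)
  moreover have "orlicz_norm \<phi> \<omega> y = 1"
    by (rule norm[OF y, of 0]) (use c in \<open>auto simp: y_def\<close>)
  moreover have "orlicz_norm \<phi> \<omega> (\<lambda>s. (c - y s) / 2) = 1"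
    by (rule norm[of _ "1/2"]) (use c y in \<open>auto simp: y_def\<close>)
  moreover have "orlicz_norm \<phi> \<omega> (\<lambda>s. (c + y s) / 2) = 1"
    by (rule norm[of _ 0]) (use c y in \<open>auto simp: y_def\<close>)
  ultimately show False using ns const unfolding non_square_def by fastforce
qed

end

section \<open>The characterisation by the support of the weight\<close>

theorem theorem3p2:
  fixes \<phi> \<omega> :: "real \<Rightarrow> real"
  assumes "orlicz_function \<phi>"
    and "weight_function \<omega>"
    and "\<exists>t\<in>{0<..<1}. \<omega> t \<noteq> 0"
  shows "non_square (orlicz_lorentz_space \<phi> \<omega>) (orlicz_norm \<phi> \<omega>) \<longleftrightarrow>
         Sup {t\<in>{0..<1}. 0 < \<omega> t} \<in> {1/2<..1}"
proof -
  let ?\<alpha> = "Sup {t\<in>{0..<1}. 0 < \<omega> t}"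
  obtain t\<^sub>0 where t0: "0 < t\<^sub>0" "t\<^sub>0 < 1" "\<omega> t\<^sub>0 \<noteq> 0" using assms(3) by auto
  \<comment> \<open>The supremum of an empty set of reals is an unspecified value, so nonemptiness
    is secured first.\<close>
  then have ne: "{t\<in>{0..<1}. 0 < \<omega> t} \<noteq> {}"
    using weight_nonneg[OF assms(2), of t\<^sub>0] by force
  have le1: "?\<alpha> \<le> 1" by (rule cSup_least[OF ne]) auto
  show ?thesis
  proof
    assume ns: "non_square (orlicz_lorentz_space \<phi> \<omega>) (orlicz_norm \<phi> \<omega>)"
    show "?\<alpha> \<in> {1/2<..1}"
    proof (rule ccontr)
      assume "?\<alpha> \<notin> {1/2<..1}"
      then have "?\<alpha> \<le> 1/2" using le1 greaterThanAtMost_iff not_le by blast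
      then have "\<omega> t = 0" if "1/2 < t" "t < 1" for t
        using weight_zero[OF assms(2), of t] that by linarith
      then show False using not_non_square[OF assms(1,2) t0] ns by blast
    qed
  next
    assume "?\<alpha> \<in> {1/2<..1}"
    then have "1/2 < ?\<alpha>" by (simp only: greaterThanAtMost_iff)
    then show "non_square (orlicz_lorentz_space \<phi> \<omega>) (orlicz_norm \<phi> \<omega>)"
      unfolding non_square_def orlicz_lorentz_space_def
      using non_square_pair[OF assms(1,2)] weight_pos[OF assms(2) ne] by auto
  qed
qed

end
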